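(* Let $1<p<\infty$. The sets $\Lambda_0^{\mathrm{even}}=\{2m: m\in\mathbb Z\}$ and $\Lambda_0^{\mathrm{odd}}=\{2m+1: m\in\mathbb Z\}$ are sampling sets for $H^p$. More precisely, there exists a constant $C_p>0$ such that for every $f\in H^p$, $$\|f|_{\Lambda_0^{\mathrm{even}}}\|_{\ell^p}\leqslant\|f\|_{H^p}\leqslant C_p\,\|f|_{\Lambda_0^{\mathrm{even}}}\|_{\ell^p}.$$ The same conclusion holds with $\Lambda_0^{\mathrm{even}}$ replaced by $\Lambda_0^{\mathrm{odd}}$.
   Context: Lattice points $(m,n)\in\mathbb Z^2$ are identified with $m+in\in\mathbb C$. Let $\mathbb Z^2_+=\{m+in: m,n\in\mathbb Z,\ n\geqslant 0\}$. A function $f:\mathbb Z^2_+\to\mathbb C$ is discrete holomorphic, written $f\in\operatorname{Hol}(\mathbb Z^2_+)$, if $f(z)+i f(z+1)-f(z+1+i)-i f(z+i)=0$ for every $z\in\mathbb Z^2_+$. For $1\leqslant p\leqslant\infty$, $H^p=H^p(\mathbb Z^2_+)=\{f\in\operatorname{Hol}(\mathbb Z^2_+): \|f\|_{H^p}:=\sup_{n\geqslant 0}\|f(\cdot+in)\|_{\ell^p(\mathbb Z)}<\infty\}$. For $\Lambda\subseteq\mathbb Z^2_+$, $\|f|_\Lambda\|_{\ell^p}=\big(\sum_{\lambda\in\Lambda}|f(\lambda)|^p\big)^{1/p}$; "sampling set for $H^p$" means precisely that $\|f|_\Lambda\|_{\ell^p}$ and $\|f\|_{H^p}$ are comparable,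 uniformly in $f\in H^p$. *)

theory Defs
  imports "HOL-Analysis.Analysis"
begin

(* The lattice points (m, n) with n \<ge> 0, as complex numbers m + in.  A function on Z2_plus is
   represented by a total function complex \<Rightarrow> complex; no notion below depends on its values
   outside Z2_plus. *)
definition Z2_plus :: "complex set" where
  "Z2_plus = {of_int m + \<i> * of_int n | m n :: int. n \<ge> 0}"

definition Hol :: "(complex \<Rightarrow> complex) set" where
  "Hol = {f. \<forall>z\<in>Z2_plus. f z + \<i> * f (z + 1) - f (z + 1 + \<i>) - \<i> * f (z + \<i>) = 0}"

(* The l^p norm over an index set A for finite exponents p \<ge> 1.  It takes the value \<infinity> when the
   p-th powers are not summable; the infinite sum is taken in ennreal, hence always exists. *)
definition lp_norm :: "real \<Rightarrow> 'a set \<Rightarrow> ('a \<Rightarrow> complex) \<Rightarrow> ennreal" where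
  "lp_norm p A g =
     (let S = (\<Sum>\<^sub>\<infinity>x\<in>A. ennreal (cmod (g x) powr p))
      in if S = \<infinity> then \<infinity> else ennreal (enn2real S powr (1 / p)))"

definition Hp_norm :: "real \<Rightarrow> (complex \<Rightarrow> complex) \<Rightarrow> ennreal" where
  "Hp_norm p f = (SUP n::nat. lp_norm p (UNIV :: int set) (\<lambda>m. f (of_int m + \<i> * of_nat n)))"

definition Hp :: "real \<Rightarrow> (complex \<Rightarrow> complex) set" where
  "Hp p = {f \<in> Hol. Hp_norm p f < \<infinity>}"

definition sampling_set :: "real \<Rightarrow> complex set \<Rightarrow> bool" where
  "sampling_set p \<Lambda> \<longleftrightarrow> \<Lambda> \<subseteq> Z2_plus \<and>
     (\<exists>c C :: real. c > 0 \<and> C > 0 \<and>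
       (\<forall>f\<in>Hp p. ennreal c * lp_norm p \<Lambda> f \<le> Hp_norm p f \<and>
                 Hp_norm p f \<le> ennreal C * lp_norm p \<Lambda> f))"

definition Lambda0_even :: "complex set" where
  "Lambda0_even = {of_int (2 * m) | m :: int. True}"

definition Lambda0_odd :: "complex set" where
  "Lambda0_odd = {of_int (2 * m + 1) | m :: int. True}"

end

theory Submission
  imports Defs "HOL-Real_Asymp.Real_Asymp"
begin

text \<open>On each of the two parity classes of lattice points a discrete holomorphic function is harmonic
  for the diagonal neighbours, so by Jensen the sums of \<open>|f|\<^sup>p\<close> over the class in the \<open>n\<close>-th row form a
  convex sequence in \<open>n\<close>.  For \<open>f \<in> H\<^sup>p\<close> this sequence is bounded, hence decreasing, and everything
  is controlled by the boundary row.  There the odd values are the discrete Hilbert transform of the even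
  ones: this is exact for an explicit kernel, an integral over \<open>[-1, 1]\<close> of powers of the Cayley
  transform, and follows for every \<open>f \<in> H\<^sup>p\<close> from the same convexity.  The Hilbert transform is bounded on
  \<open>\<ell>\<^sup>p\<close> by Cotlar's identity for \<open>p = 2, 4, 8, \<dots>\<close>, interpolation for \<open>p > 2\<close>, and duality for
  \<open>p < 2\<close>.\<close>

section \<open>Powers and sums\<close>

text \<open>The two parity classes are linked only through differences: a function that is 0 on one
  class and constant on the other is discrete holomorphic. Even boundary values therefore fix the
  odd ones only up to an additive constant, and summability of p-th powers with \<open>p\<close>
  finite is what removes it. Moreover, an arbitrary element of H^p is not given by an integral
  formula in advance. It is compared with finite superpositions of kernels, and these need bounded
  rows so that convexity applies to the difference. The kernel decays like \<open>1 / |m|\<close>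
  along the boundary, hence lies in l^p only for \<open>1 < p\<close>, which is also the range where
  the Hilbert transform is bounded. The convexity argument gives a bound free of the a priori row
  bound, so row bounds that change with the approximation are admissible. Estimates are stated for
  finite sets with constants independent of the set.\<close>

lemma powr_add_le:
  fixes x y p :: real
  assumes "0 \<le> x" "0 \<le> y" "0 \<le> p"
  shows "(x + y) powr p \<le> 2 powr p * (x powr p + y powr p)"
proof -
  have "(x + y) powr p \<le> (2 * max x y) powr p"
    using assms by (intro powr_mono2) auto
  also have "\<dots> = 2 powr p * max x y powr p"
    using assms by (simp add: powr_mult)
  also have "\<dots> \<le> 2 powr p * (x powr p + y powr p)"
    by (intro mult_left_mono) (auto simp: max_def)
  finally show ?thesis .
qed

lemma convex_on_powr_nonneg:
  fixes p :: real
  assumes "1 \<le> p"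
  shows "convex_on {0..} (\<lambda>x. x powr p)"
proof (rule convex_onI)
  fix t x y :: real
  assume t: "0 < t" "t < 1" and xy: "x \<in> {0..}" "y \<in> {0..}"
  have le: "s powr p \<le> s" if "0 < s" "s < 1" for s :: real
    using powr_mono'[of 1 p s] that assms by simp
  consider "x = 0" | "y = 0" | "0 < x" "0 < y" using xy by force
  then show "((1 - t) *\<^sub>R x + t *\<^sub>R y) powr p \<le> (1 - t) * x powr p + t * y powr p"
  proof cases
    case 1
    then show ?thesis using t xy le[of t] by (simp add: powr_mult mult_right_mono)
  next
    case 2
    then show ?thesis using t xy le[of "1 - t"] by (simp add: powr_mult mult_right_mono)
  next
    case 3
    then show ?thesis
      using convex_onD[OF powr_convex[OF assms], of t x y] t by simp
  qed
qed simp

text \<open>Jensen for the weights divided by their sum \<open>V\<close>; this normalisation cancels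
  one factor of \<open>V powr p\<close>. An upper bound \<open>W\<close> replaces the exact mass
  because finite windows of \<open>1 / k^2\<close> have varying mass.\<close>

lemma powr_weighted_sum_le:
  fixes p :: real and w x :: "'a \<Rightarrow> real"
  assumes "1 \<le> p" "finite A" "\<And>j. j \<in> A \<Longrightarrow> 0 \<le> w j" "\<And>j. j \<in> A \<Longrightarrow> 0 \<le> x j" "(\<Sum>j\<in>A. w j) \<le> W"
  shows "(\<Sum>j\<in>A. w j * x j) powr p \<le> W powr (p - 1) * (\<Sum>j\<in>A. w j * x j powr p)"
proof (cases "(\<Sum>j\<in>A. w j) = 0")
  case True
  then have "\<forall>j\<in>A. w j = 0" using assms by (simp add: sum_nonneg_eq_0_iff)
  then show ?thesis by simp
next
  case False
  define V where "V = (\<Sum>j\<in>A. w j)"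
  have V: "V > 0" using False assms(3) unfolding V_def by (metis sum_nonneg less_eq_real_def)
  have "A \<noteq> {}" using False by auto
  have nn: "0 \<le> (\<Sum>j\<in>A. w j * x j powr p)" by (intro sum_nonneg) (use assms in auto)
  have s1: "(\<Sum>j\<in>A. w j / V) = 1" using V by (simp add: sum_divide_distrib[symmetric] V_def)
  have "(\<Sum>j\<in>A. (w j / V) *\<^sub>R x j) powr p \<le> (\<Sum>j\<in>A. (w j / V) * x j powr p)"
    by (rule convex_on_sum[OF assms(2) \<open>A \<noteq> {}\<close> convex_on_powr_nonneg[OF assms(1)] s1])
       (use assms V in auto)
  then have j: "((\<Sum>j\<in>A. w j * x j) / V) powr p \<le> (\<Sum>j\<in>A. w j * x j powr p) / V"
    by (simp add: sum_divide_distrib)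
  have "(\<Sum>j\<in>A. w j * x j) powr p = V powr p * ((\<Sum>j\<in>A. w j * x j) / V) powr p"
    using V assms by (subst powr_mult[symmetric]) (auto intro!: sum_nonneg divide_nonneg_pos)
  also have "\<dots> \<le> V powr p * ((\<Sum>j\<in>A. w j * x j powr p) / V)"
    by (intro mult_left_mono j) simp
  also have "\<dots> = V powr (p - 1) * (\<Sum>j\<in>A. w j * x j powr p)"
    using V by (simp add: powr_diff)
  also have "\<dots> \<le> W powr (p - 1) * (\<Sum>j\<in>A. w j * x j powr p)"
    by (intro mult_right_mono powr_mono2 nn) (use assms V in \<open>auto simp: V_def\<close>)
  finally show ?thesis .
qed

text \<open>Each absolute value is attained at most once on either half-line, hence the factor
  2.\<close>

lemma sum_nat_abs_le:
  fixes g :: "nat \<Rightarrow> real"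
  assumes "summable g" "\<And>n. 0 \<le> g n" "finite B"
  shows "(\<Sum>m\<in>B. g (nat \<bar>m\<bar>)) \<le> 2 * suminf g"
proof -
  have half: "(\<Sum>m\<in>D. g (nat \<bar>m\<bar>)) \<le> suminf g" if "finite D" "inj_on (\<lambda>m. nat \<bar>m\<bar>) D" for D :: "int set"
  proof -
    have "(\<Sum>m\<in>D. g (nat \<bar>m\<bar>)) = sum g ((\<lambda>m. nat \<bar>m\<bar>) ` D)"
      using that by (simp add: sum.reindex)
    also have "\<dots> \<le> suminf g" using assms that by (intro sum_le_suminf) auto
    finally show ?thesis .
  qed
  have "(\<Sum>m\<in>B. g (nat \<bar>m\<bar>)) = (\<Sum>m\<in>{m\<in>B. 0 \<le> m} \<union> {m\<in>B. m < 0}. g (nat \<bar>m\<bar>))"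
    by (rule sum.cong) auto
  also have "\<dots> = (\<Sum>m\<in>{m\<in>B. 0 \<le> m}. g (nat \<bar>m\<bar>)) + (\<Sum>m\<in>{m\<in>B. m < 0}. g (nat \<bar>m\<bar>))"
    using assms by (intro sum.union_disjoint) auto
  also have "\<dots> \<le> suminf g + suminf g"
    using assms by (intro add_mono half) (auto simp: inj_on_def)
  finally show ?thesis by simp
qed

section \<open>The discrete Hilbert transform\<close>

text \<open>The diagonal terms of both kernels vanish because of \<open>x / 0 = 0\<close>.\<close>

definition hilb :: "int set \<Rightarrow> (int \<Rightarrow> real) \<Rightarrow> int \<Rightarrow> real" where
  "hilb A a k = (\<Sum>j\<in>A. a j / of_int (k - j))"

definition sqconv :: "int set \<Rightarrow> (int \<Rightarrow> real) \<Rightarrow> int \<Rightarrow> real" where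
  "sqconv A a k = (\<Sum>j\<in>A. a j / (of_int (k - j))\<^sup>2)"

text \<open>Input and output are cut to the same finite set: the matrix stays antisymmetric, as
  duality requires, and the transform can be iterated, as Cotlar's identity requires.
  \<open>C\<close> bounds p-th powers, so it corresponds to the p-th power of an operator
  norm.\<close>

definition hilb_bounded :: "real \<Rightarrow> real \<Rightarrow> bool" where
  "hilb_bounded p C \<longleftrightarrow> 0 \<le> C \<and> (\<forall>A a. finite A \<longrightarrow>
     (\<Sum>k\<in>A. \<bar>hilb A a k\<bar> powr p) \<le> C * (\<Sum>k\<in>A. \<bar>a k\<bar> powr p))"

lemma inverse_squares_bounded:
  obtains \<kappa> :: real where "0 \<le> \<kappa>" "\<And>A k. finite A \<Longrightarrow> (\<Sum>j\<in>A. 1 / (of_int (k - j))\<^sup>2) \<le> \<kappa>"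
proof -
  define g :: "nat \<Rightarrow> real" where "g n = inverse (real n ^ 2)" for n
  have s: "summable g" unfolding g_def by (rule inverse_power_summable) simp
  have "(\<Sum>j\<in>A. 1 / (of_int (k - j))\<^sup>2) \<le> 2 * suminf g" if "finite A" for A :: "int set" and k
  proof -
    have "(\<Sum>j\<in>A. 1 / (of_int (k - j))\<^sup>2) = (\<Sum>j\<in>A. g (nat \<bar>k - j\<bar>))"
      by (intro sum.cong) (auto simp: g_def divide_simps power2_eq_square)
    also have "\<dots> = (\<Sum>m\<in>(\<lambda>j. k - j) ` A. g (nat \<bar>m\<bar>))"
      by (subst sum.reindex) (auto simp: inj_on_def)
    also have "\<dots> \<le> 2 * suminf g"
      by (rule sum_nat_abs_le[OF s]) (auto simp: g_def that)
    finally show ?thesis .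
  qed
  moreover have "0 \<le> 2 * suminf g" using suminf_nonneg[OF s] by (simp add: g_def)
  ultimately show thesis using that by blast
qed

text \<open>Young's inequality for convolution with an l^1 kernel: Jensen at each \<open>k\<close>
  yields \<open>\<kappa> powr (p - 1)\<close>, and exchanging the sums yields the remaining factor
  \<open>\<kappa>\<close>.\<close>

lemma sqconv_bounded:
  fixes p :: real
  assumes "1 \<le> p" "finite A" and \<kappa>: "0 \<le> \<kappa>" "\<And>A k. finite A \<Longrightarrow> (\<Sum>j\<in>A. 1 / (of_int (k - j))\<^sup>2) \<le> \<kappa>"
  shows "(\<Sum>k\<in>A. \<bar>sqconv A a k\<bar> powr p) \<le> \<kappa> powr p * (\<Sum>k\<in>A. \<bar>a k\<bar> powr p)"
proof -
  have "\<bar>sqconv A a k\<bar> powr p \<le> \<kappa> powr (p - 1) * (\<Sum>j\<in>A. 1 / (of_int (k - j))\<^sup>2 * \<bar>a j\<bar> powr p)" for k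
  proof -
    have "\<bar>sqconv A a k\<bar> \<le> (\<Sum>j\<in>A. 1 / (of_int (k - j))\<^sup>2 * \<bar>a j\<bar>)"
      unfolding sqconv_def by (rule order_trans[OF sum_abs]) (simp add: abs_mult)
    then have "\<bar>sqconv A a k\<bar> powr p \<le> (\<Sum>j\<in>A. 1 / (of_int (k - j))\<^sup>2 * \<bar>a j\<bar>) powr p"
      using assms by (intro powr_mono2) auto
    also have "\<dots> \<le> \<kappa> powr (p - 1) * (\<Sum>j\<in>A. 1 / (of_int (k - j))\<^sup>2 * \<bar>a j\<bar> powr p)"
      by (rule powr_weighted_sum_le) (use assms in auto)
    finally show ?thesis .
  qed
  then have "(\<Sum>k\<in>A. \<bar>sqconv A a k\<bar> powr p)
     \<le> (\<Sum>k\<in>A. \<kappa> powr (p - 1) * (\<Sum>j\<in>A. 1 / (of_int (k - j))\<^sup>2 * \<bar>a j\<bar> powr p))"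
    by (intro sum_mono)
  also have "\<dots> = \<kappa> powr (p - 1) * (\<Sum>j\<in>A. \<bar>a j\<bar> powr p * (\<Sum>k\<in>A. 1 / (of_int (j - k))\<^sup>2))"
    unfolding sum_distrib_left[symmetric]
    by (subst sum.swap) (simp add: sum_distrib_left sum_distrib_right mult.commute power2_commute)
  also have "\<dots> \<le> \<kappa> powr (p - 1) * (\<Sum>j\<in>A. \<bar>a j\<bar> powr p * \<kappa>)"
    by (intro mult_left_mono sum_mono \<kappa> assms) auto
  also have "\<dots> = \<kappa> powr p * (\<Sum>j\<in>A. \<bar>a j\<bar> powr p)"
    using \<kappa>(1) by (cases "\<kappa> = 0") (simp_all add: sum_distrib_right[symmetric] powr_diff)
  finally show ?thesis .
qed

section \<open>Cotlar's identity and the exponents 2, 4, 8, ..\<close>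

lemma cotlar_kernel:
  fixes j k l :: int
  shows "1 / of_int (k - j) * (1 / of_int (k - l)) =
    1 / of_int (k - j) * (1 / of_int (j - l)) + 1 / of_int (k - l) * (1 / of_int (l - j))
    + ((if j = l then 1 else 0) + (if k = l then 1 else 0)) * (1 / (of_int (k - j))\<^sup>2)
    + (if k = j then 1 else 0) * (1 / (of_int (k - l))\<^sup>2 :: real)"
proof -
  \<comment> \<open>For distinct points this is a partial fraction identity. At a coincidence the
    convention \<open>1 / 0 = 0\<close> leaves a defect of one inverse square: \<open>j = l\<close>
    kills both mixed products on the right, while \<open>k = j\<close> or \<open>k = l\<close> kills
    the left side. The indicator terms make up for it.\<close>
  consider "j = l" | "j \<noteq> l" "k = j" | "j \<noteq> l" "k = l" | "j \<noteq> l" "k \<noteq> j" "k \<noteq> l" by blast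
  then show ?thesis
  proof cases
    case 4
    then have "of_int k - of_int j \<noteq> (0::real)" "of_int k - of_int l \<noteq> (0::real)"
      "of_int j - of_int l \<noteq> (0::real)" "of_int l - of_int j \<noteq> (0::real)" by auto
    then show ?thesis using 4 by (simp add: divide_simps) (simp add: algebra_simps)
  next
    case 2
    then have "of_int j - of_int l \<noteq> (0::real)" "of_int l - of_int j \<noteq> (0::real)" by auto
    then show ?thesis using 2 by (simp add: divide_simps power2_eq_square)
  next
    case 3
    then have "of_int j - of_int l \<noteq> (0::real)" "of_int l - of_int j \<noteq> (0::real)" by auto
    then show ?thesis using 3 by (simp add: divide_simps power2_eq_square)
  qed (simp add: power2_eq_square)
qed

text \<open>The square is a double sum over \<open>cotlar_kernel\<close>. The two mixed products
  agree after exchanging \<open>j\<close> and \<open>l\<close>, hence the factor 2; the coincidences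
  of \<open>k\<close> with \<open>j\<close> and with \<open>l\<close> both contribute
  \<open>a k * sqconv A a k\<close>.\<close>

lemma cotlar_identity:
  assumes "finite A" "k \<in> A"
  shows "(hilb A a k)\<^sup>2 = sqconv A (\<lambda>j. (a j)\<^sup>2) k + 2 * hilb A (\<lambda>j. a j * hilb A a j) k
           + 2 * (a k * sqconv A a k)"
proof -
  let ?h = "\<lambda>i j. 1 / (of_int (i - j)) :: real"
  let ?q = "\<lambda>i j. 1 / (of_int (i - j))\<^sup>2 :: real"
  have "(hilb A a k)\<^sup>2 = (\<Sum>j\<in>A. \<Sum>l\<in>A. a j * a l * (?h k j * ?h k l))"
    unfolding hilb_def power2_eq_square sum_product by (simp add: mult_ac)
  also have "\<dots> = (\<Sum>j\<in>A. \<Sum>l\<in>A. a j * a l * (?h k j * ?h j l)) + (\<Sum>j\<in>A. \<Sum>l\<in>A. a j * a l * (?h k l * ?h l j))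
     + (\<Sum>j\<in>A. \<Sum>l\<in>A. if j = l then a j * a l * ?q k j else 0)
     + (\<Sum>j\<in>A. \<Sum>l\<in>A. if k = l then a j * a l * ?q k j else 0)
     + (\<Sum>j\<in>A. \<Sum>l\<in>A. if k = j then a j * a l * ?q k l else 0)"
    unfolding sum.distrib[symmetric] by (intro sum.cong refl, subst cotlar_kernel) (simp add: algebra_simps)
  also have "(\<Sum>j\<in>A. \<Sum>l\<in>A. a j * a l * (?h k l * ?h l j)) = (\<Sum>j\<in>A. \<Sum>l\<in>A. a j * a l * (?h k j * ?h j l))"
    by (subst sum.swap) (simp add: mult_ac)
  also have "(\<Sum>j\<in>A. \<Sum>l\<in>A. a j * a l * (?h k j * ?h j l)) = hilb A (\<lambda>j. a j * hilb A a j) k"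
    unfolding hilb_def by (simp add: sum_distrib_left sum_divide_distrib mult_ac)
  also have "(\<Sum>j\<in>A. \<Sum>l\<in>A. if j = l then a j * a l * ?q k j else 0) = sqconv A (\<lambda>j. (a j)\<^sup>2) k"
    unfolding sqconv_def using assms by (simp add: power2_eq_square)
  also have "(\<Sum>j\<in>A. \<Sum>l\<in>A. if k = l then a j * a l * ?q k j else 0) = a k * sqconv A a k"
    unfolding sqconv_def using assms by (simp add: sum_distrib_left mult_ac)
  also have "(\<Sum>j\<in>A. \<Sum>l\<in>A. if k = j then a j * a l * ?q k l else 0) = (\<Sum>j\<in>A. if k = j then (\<Sum>l\<in>A. a j * a l * ?q k l) else 0)"
    by (intro sum.cong) auto
  also have "\<dots> = a k * sqconv A a k"
    unfolding sqconv_def using assms by (simp add: sum_distrib_left mult_ac)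
  finally show ?thesis by simp
qed

text \<open>At \<open>j = 0\<close> the summand is odd. Moving \<open>j\<close> by one replaces a
  term at one end of the window by a term at the other end, and both tend to 0.\<close>

lemma symmetric_harmonic_tendsto_0:
  "(\<lambda>N. \<Sum>k\<in>{- int N..int N}. 1 / of_int (k - j) :: real) \<longlonglongrightarrow> 0"
proof (induction j rule: int_induct[where k = 0])
  case base
  have "(\<Sum>k\<in>{- int N..int N}. 1 / of_int (k - 0) :: real) = 0" for N
  proof -
    have "(\<Sum>k\<in>{- int N..int N}. 1 / of_int k :: real) = (\<Sum>k\<in>{- int N..int N}. 1 / of_int (- k))"
      by (rule sum.reindex_bij_witness[of _ uminus uminus]) auto
    then show ?thesis by (simp add: sum_negf)
  qed
  then show ?case by simp
next
  case (step1 i)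
  have shift: "(\<Sum>k\<in>{- int N..int N}. 1 / of_int (k - (i + 1)) :: real) =
     (\<Sum>k\<in>{- int N..int N}. 1 / of_int (k - i)) + (1 / of_int (- int N - 1 - i) - 1 / of_int (int N - i))" for N
  proof -
    have "(\<Sum>k\<in>{- int N..int N}. 1 / of_int (k - (i + 1)) :: real) = (\<Sum>k\<in>{- int N - 1..int N - 1}. 1 / of_int (k - i))"
      by (rule sum.reindex_bij_witness[of _ "\<lambda>k. k + 1" "\<lambda>k. k - 1"]) (auto simp: algebra_simps)
    moreover have "{- int N - 1..int N - 1} = insert (- int N - 1) {- int N..int N - 1}" 
        "{- int N..int N} = insert (int N) {- int N..int N - 1}" by auto
    ultimately show ?thesis by simp
  qed
  have "(\<lambda>N. 1 / of_int (- int N - 1 - i) - 1 / of_int (int N - i) :: real) \<longlonglongrightarrow> 0" 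
    by real_asymp
  from tendsto_add[OF step1(2) this] show ?case unfolding shift by simp
next
  case (step2 i)
  have shift: "(\<Sum>k\<in>{- int N..int N}. 1 / of_int (k - (i - 1)) :: real) =
     (\<Sum>k\<in>{- int N..int N}. 1 / of_int (k - i)) + (1 / of_int (int N + 1 - i) - 1 / of_int (- int N - i))" for N
  proof -
    have "(\<Sum>k\<in>{- int N..int N}. 1 / of_int (k - (i - 1)) :: real) = (\<Sum>k\<in>{- int N + 1..int N + 1}. 1 / of_int (k - i))"
      by (rule sum.reindex_bij_witness[of _ "\<lambda>k. k - 1" "\<lambda>k. k + 1"]) (auto simp: algebra_simps)
    moreover have "{- int N + 1..int N + 1} = insert (int N + 1) {- int N + 1..int N}" 
        "{- int N..int N} = insert (- int N) {- int N + 1..int N}" by auto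
    ultimately show ?thesis by simp
  qed
  have "(\<lambda>N. 1 / of_int (int N + 1 - i) - 1 / of_int (- int N - i) :: real) \<longlonglongrightarrow> 0" 
    by real_asymp
  from tendsto_add[OF step2(2) this] show ?case unfolding shift by simp
qed

lemma hilb_add: "hilb A (\<lambda>j. a j + b j) k = hilb A a k + hilb A b k"
  by (simp add: hilb_def add_divide_distrib sum.distrib)

lemma hilb_antisym: "(\<Sum>k\<in>A. w k * hilb A a k) = - (\<Sum>j\<in>A. a j * hilb A w j)"
proof -
  have "(\<Sum>k\<in>A. w k * hilb A a k) = (\<Sum>j\<in>A. \<Sum>k\<in>A. a j * (w k / of_int (k - j)))"
    unfolding hilb_def sum_distrib_left by (subst sum.swap) (simp add: mult_ac)
  also have "\<dots> = (\<Sum>j\<in>A. \<Sum>k\<in>A. - (a j * (w k / of_int (j - k))))"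
  proof (intro sum.cong refl)
    fix j k :: int
    have "w k / of_int (k - j) = - (w k / of_int (j - k))"
      by (metis minus_diff_eq minus_divide_right of_int_minus)
    then show "a j * (w k / of_int (k - j)) = - (a j * (w k / of_int (j - k)))" by simp
  qed
  finally show ?thesis by (simp add: hilb_def sum_distrib_left sum_negf)
qed

text \<open>Cotlar's identity is summed over \<open>{-N..N}\<close>, where the Hilbert transform term tends to 0.\<close>

lemma hilb_bounded_2: "\<exists>C. hilb_bounded 2 C"
proof -
  obtain \<kappa> :: real where \<kappa>: "0 \<le> \<kappa>" "\<And>A k. finite A \<Longrightarrow> (\<Sum>j\<in>A. 1 / (of_int (k - j))\<^sup>2) \<le> \<kappa>"
    using inverse_squares_bounded by blast
  \<comment> \<open>One \<open>\<kappa>\<close> comes from the convolution of the squares, two from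
    the doubled diagonal term.\<close>
  have "(\<Sum>k\<in>A. (hilb A a k)\<^sup>2) \<le> 3 * \<kappa> * (\<Sum>k\<in>A. (a k)\<^sup>2)" if A: "finite A" for A a
  proof -
    \<comment> \<open>Extension by zero lets the window grow while the transform of the data stays
      the same.\<close>
    define c where "c = (\<lambda>j. if j \<in> A then a j else 0)"
    define K where "K = (\<lambda>N::nat. {- int N..int N})"
    define s where "s = (\<lambda>N j. \<Sum>k\<in>K N. 1 / of_int (k - j) :: real)"
    define S where "S = (\<Sum>k\<in>A. (a k)\<^sup>2)"
    have fin: "finite (K N)" for N by (simp add: K_def)
    have lim: "(\<lambda>N. 3 * \<kappa> * S + 2 * (\<Sum>j\<in>A. a j * hilb A a j * s N j)) \<longlonglongrightarrow> 3 * \<kappa> * S + 2 * (\<Sum>j\<in>A. a j * hilb A a j * 0)"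
      unfolding s_def K_def by (intro tendsto_intros symmetric_harmonic_tendsto_0)
    obtain N0 where N0: "A \<subseteq> K N0"
    proof
      show "A \<subseteq> K (nat (\<Sum>j\<in>A. \<bar>j\<bar>))"
      proof
        fix j assume "j \<in> A"
        then have "\<bar>j\<bar> \<le> (\<Sum>j\<in>A. \<bar>j\<bar>)" using A by (intro member_le_sum) auto
        then show "j \<in> K (nat (\<Sum>j\<in>A. \<bar>j\<bar>))" by (auto simp: K_def)
      qed
    qed
    have bound: "(\<Sum>k\<in>A. (hilb A a k)\<^sup>2) \<le> 3 * \<kappa> * S + 2 * (\<Sum>j\<in>A. a j * hilb A a j * s N j)" if "N \<ge> N0" for N
    proof -
      have AK: "A \<subseteq> K N" using N0 that by (auto simp: K_def)
      have restr: "(\<Sum>j\<in>K N. g j) = (\<Sum>j\<in>A. g j)" if "\<And>j. j \<notin> A \<Longrightarrow> g j = 0" for g :: "int \<Rightarrow> real"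
        by (rule sum.mono_neutral_right) (use AK fin that in auto)
      have hc: "hilb (K N) c k = hilb A a k" for k
        unfolding hilb_def by (subst restr) (auto simp: c_def)
      have csq: "(\<Sum>k\<in>K N. (c k)\<^sup>2) = S"
        unfolding S_def by (subst restr) (auto simp: c_def)
      have q: "(\<Sum>k\<in>K N. 1 / (of_int (k - j))\<^sup>2) \<le> \<kappa>" for j
        using \<kappa>(2)[OF fin, of j N] by (simp add: power2_commute)
      have t1: "(\<Sum>k\<in>K N. sqconv (K N) (\<lambda>j. (c j)\<^sup>2) k) \<le> \<kappa> * S"
      proof -
        have "(\<Sum>k\<in>K N. sqconv (K N) (\<lambda>j. (c j)\<^sup>2) k) = (\<Sum>j\<in>K N. (c j)\<^sup>2 * (\<Sum>k\<in>K N. 1 / (of_int (k - j))\<^sup>2))"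
          unfolding sqconv_def by (subst sum.swap) (simp add: sum_distrib_left)
        also have "\<dots> \<le> (\<Sum>j\<in>K N. (c j)\<^sup>2 * \<kappa>)"
          by (intro sum_mono mult_left_mono q) auto
        also have "\<dots> = \<kappa> * S"
          by (simp only: sum_distrib_right[symmetric] csq) (rule mult.commute)
        finally show ?thesis .
      qed
      have t2: "(\<Sum>k\<in>K N. c k * sqconv (K N) c k) \<le> \<kappa> * S"
      proof -
        have "(\<Sum>k\<in>K N. c k * sqconv (K N) c k) 
           \<le> (\<Sum>k\<in>K N. \<Sum>j\<in>K N. (c k)\<^sup>2 / 2 * (1 / (of_int (k - j))\<^sup>2) + (c j)\<^sup>2 / 2 * (1 / (of_int (k - j))\<^sup>2))"
        proof (subst sqconv_def, subst sum_distrib_left, intro sum_mono)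
          fix k j :: int
          have "c k * c j \<le> (c k)\<^sup>2 / 2 + (c j)\<^sup>2 / 2" using sum_squares_bound[of "c k" "c j"] by simp
          then have "(c k * c j) * (1 / (of_int (k - j))\<^sup>2) \<le> ((c k)\<^sup>2 / 2 + (c j)\<^sup>2 / 2) * (1 / (of_int (k - j))\<^sup>2)"
            by (intro mult_right_mono) auto
          then show "c k * (c j / (of_int (k - j))\<^sup>2) \<le> (c k)\<^sup>2 / 2 * (1 / (of_int (k - j))\<^sup>2) + (c j)\<^sup>2 / 2 * (1 / (of_int (k - j))\<^sup>2)"
            by (simp add: add_divide_distrib)
        qed
        also have "\<dots> = (\<Sum>k\<in>K N. (c k)\<^sup>2 / 2 * (\<Sum>j\<in>K N. 1 / (of_int (k - j))\<^sup>2)) + (\<Sum>j\<in>K N. (c j)\<^sup>2 / 2 * (\<Sum>k\<in>K N. 1 / (of_int (k - j))\<^sup>2))"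
          unfolding sum.distrib sum_distrib_left by (subst (2) sum.swap) simp
        also have "\<dots> \<le> (\<Sum>k\<in>K N. (c k)\<^sup>2 / 2 * \<kappa>) + (\<Sum>j\<in>K N. (c j)\<^sup>2 / 2 * \<kappa>)"
          by (intro add_mono sum_mono mult_left_mono q \<kappa>(2) fin) auto
        also have "\<dots> = \<kappa> * S"
          by (simp add: sum_distrib_right[symmetric] sum_divide_distrib[symmetric] csq)
        finally show ?thesis .
      qed
      \<comment> \<open>Summation over \<open>k\<close> first leaves the column sums
        \<open>s N j\<close>, with finitely many coefficients that do not depend on
        \<open>N\<close>.\<close>
      have t3: "(\<Sum>k\<in>K N. hilb (K N) (\<lambda>j. c j * hilb (K N) c j) k) = (\<Sum>j\<in>A. a j * hilb A a j * s N j)"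
      proof -
        have "(\<Sum>k\<in>K N. hilb (K N) (\<lambda>j. c j * hilb (K N) c j) k) = (\<Sum>j\<in>K N. c j * hilb A a j * s N j)"
          unfolding s_def hc by (subst hilb_def, subst sum.swap) (simp add: sum_distrib_left)
        also have "\<dots> = (\<Sum>j\<in>A. a j * hilb A a j * s N j)"
          by (subst restr) (auto simp: c_def)
        finally show ?thesis .
      qed
      have "(\<Sum>k\<in>A. (hilb A a k)\<^sup>2) \<le> (\<Sum>k\<in>K N. (hilb (K N) c k)\<^sup>2)"
        unfolding hc by (intro sum_mono2 fin AK) auto
      also have "\<dots> = (\<Sum>k\<in>K N. sqconv (K N) (\<lambda>j. (c j)\<^sup>2) k) + 2 * (\<Sum>k\<in>K N. hilb (K N) (\<lambda>j. c j * hilb (K N) c j) k)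
           + 2 * (\<Sum>k\<in>K N. c k * sqconv (K N) c k)"
        by (simp add: cotlar_identity[OF fin] sum.distrib sum_distrib_left)
      finally show ?thesis using t1 t2 t3 by simp
    qed
    have "(\<Sum>k\<in>A. (hilb A a k)\<^sup>2) \<le> 3 * \<kappa> * S + 2 * (\<Sum>j\<in>A. a j * hilb A a j * 0)"
      by (rule tendsto_lowerbound[OF lim]) (auto simp: eventually_sequentially intro: bound)
    then show ?thesis by (simp add: S_def)
  qed
  then have "hilb_bounded 2 (3 * \<kappa>)"
    using \<kappa>(1) by (auto simp: hilb_bounded_def)
  then show ?thesis ..
qed

text \<open>Cotlar's identity bounds \<open>\<bar>hilb A a\<bar>\<close> to the power
  \<open>2 * p\<close> by harmless convolutions and by the transform of \<open>a * hilb A a\<close>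
  in l^p. The latter costs mixed products of \<open>a\<close> and \<open>hilb A a\<close>; the half
  of \<open>X\<close> that they produce is absorbed on the left, which is legitimate because
  \<open>X\<close> is a finite sum.\<close>

lemma hilb_bounded_double:
  assumes "1 \<le> p" "hilb_bounded p C"
  shows "\<exists>C'. hilb_bounded (2 * p) C'"
proof -
  obtain \<kappa> :: real where \<kappa>: "0 \<le> \<kappa>" "\<And>A k. finite A \<Longrightarrow> (\<Sum>j\<in>A. 1 / (of_int (k - j))\<^sup>2) \<le> \<kappa>"
    using inverse_squares_bounded by blast
  have C: "0 \<le> C" using assms by (simp add: hilb_bounded_def)
  \<comment> \<open>Each splitting of a sum by \<open>powr_add_le\<close>, and each factor 2 in
    Cotlar's identity, costs one \<open>c\<close>.\<close>
  define c where "c = (2::real) powr p"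
  define \<beta> where "\<beta> = c * c * c * C"
  define \<alpha> where "\<alpha> = c * c * \<kappa> powr p + c * c * c * (1 + \<kappa> powr (2 * p)) / 2"
  have c: "0 \<le> c" by (simp add: c_def)
  have sq: "(x\<^sup>2) powr p = \<bar>x\<bar> powr (2 * p)" for x :: real
    by (simp add: powr_powr[symmetric])
  have dbl: "\<bar>x\<bar> powr (2 * p) = (\<bar>x\<bar> powr p)\<^sup>2" for x :: real
    by (simp add: power2_eq_square powr_add[symmetric])
  have "(\<Sum>k\<in>A. \<bar>hilb A a k\<bar> powr (2 * p)) \<le> (2 * \<alpha> + \<beta>\<^sup>2) * (\<Sum>k\<in>A. \<bar>a k\<bar> powr (2 * p))" if A: "finite A" for A a
  proof -
    define b where "b = hilb A a"
    define X where "X = (\<Sum>k\<in>A. \<bar>b k\<bar> powr (2 * p))"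
    define Y where "Y = (\<Sum>k\<in>A. \<bar>a k\<bar> powr (2 * p))"
    define L where "L = (\<Sum>k\<in>A. \<bar>hilb A (\<lambda>j. a j * b j) k\<bar> powr p)"
    have pt: "\<bar>b k\<bar> powr (2 * p) \<le> c * c * \<bar>sqconv A (\<lambda>j. (a j)\<^sup>2) k\<bar> powr p
         + c * c * c * \<bar>hilb A (\<lambda>j. a j * b j) k\<bar> powr p + c * c * (\<bar>a k\<bar> powr p * \<bar>sqconv A a k\<bar> powr p)"
      if k: "k \<in> A" for k
    proof -
      let ?u = "\<bar>sqconv A (\<lambda>j. (a j)\<^sup>2) k\<bar>" and ?v = "\<bar>hilb A (\<lambda>j. a j * b j) k\<bar>" and ?w = "\<bar>a k\<bar> * \<bar>sqconv A a k\<bar>"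
      have "\<bar>b k\<bar> powr (2 * p) = ((b k)\<^sup>2) powr p" by (simp add: sq)
      also have "\<dots> \<le> ((?u + 2 * ?v) + 2 * ?w) powr p"
      proof (intro powr_mono2)
        have "(b k)\<^sup>2 = sqconv A (\<lambda>j. (a j)\<^sup>2) k + 2 * hilb A (\<lambda>j. a j * b j) k + 2 * (a k * sqconv A a k)"
          unfolding b_def by (rule cotlar_identity[OF A k])
        also have "\<dots> \<le> (?u + 2 * ?v) + 2 * ?w"
          unfolding abs_mult[symmetric] by (intro add_mono) auto
        finally show "(b k)\<^sup>2 \<le> (?u + 2 * ?v) + 2 * ?w" .
      qed (use assms in auto)
      also have "\<dots> \<le> c * ((?u + 2 * ?v) powr p + (2 * ?w) powr p)"
        unfolding c_def using assms by (intro powr_add_le) auto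
      also have "\<dots> \<le> c * (c * (?u powr p + (2 * ?v) powr p) + (2 * ?w) powr p)"
        using c assms by (intro mult_left_mono add_right_mono, unfold c_def, intro powr_add_le) auto
      also have "\<dots> = c * c * ?u powr p + c * c * c * ?v powr p + c * c * (\<bar>a k\<bar> powr p * \<bar>sqconv A a k\<bar> powr p)"
        by (simp add: powr_mult c_def algebra_simps)
      finally show ?thesis .
    qed
    have "X \<le> (\<Sum>k\<in>A. c * c * \<bar>sqconv A (\<lambda>j. (a j)\<^sup>2) k\<bar> powr p
         + c * c * c * \<bar>hilb A (\<lambda>j. a j * b j) k\<bar> powr p + c * c * (\<bar>a k\<bar> powr p * \<bar>sqconv A a k\<bar> powr p))"
      unfolding X_def by (intro sum_mono pt)
    also have "\<dots> = c * c * (\<Sum>k\<in>A. \<bar>sqconv A (\<lambda>j. (a j)\<^sup>2) k\<bar> powr p) + c * c * c * L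
         + c * c * (\<Sum>k\<in>A. \<bar>a k\<bar> powr p * \<bar>sqconv A a k\<bar> powr p)"
      by (simp add: sum.distrib sum_distrib_left L_def)
    also have "\<dots> \<le> c * c * (\<kappa> powr p * Y) + c * c * c * (C * (\<Sum>k\<in>A. \<bar>a k\<bar> powr p * \<bar>b k\<bar> powr p))
         + c * c * ((1 + \<kappa> powr (2 * p)) / 2 * Y)"
    proof (intro add_mono mult_left_mono)
      show "(\<Sum>k\<in>A. \<bar>sqconv A (\<lambda>j. (a j)\<^sup>2) k\<bar> powr p) \<le> \<kappa> powr p * Y"
        using sqconv_bounded[OF assms(1) A \<kappa>, of "\<lambda>j. (a j)\<^sup>2"] by (simp add: Y_def sq)
      show "L \<le> C * (\<Sum>k\<in>A. \<bar>a k\<bar> powr p * \<bar>b k\<bar> powr p)"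
      proof -
        have "L \<le> C * (\<Sum>k\<in>A. \<bar>a k * b k\<bar> powr p)"
          using assms(2) A unfolding hilb_bounded_def L_def by blast
        then show ?thesis by (simp add: abs_mult powr_mult)
      qed
      have "(\<Sum>k\<in>A. \<bar>a k\<bar> powr p * \<bar>sqconv A a k\<bar> powr p) \<le> (\<Sum>k\<in>A. (\<bar>a k\<bar> powr (2 * p) + \<bar>sqconv A a k\<bar> powr (2 * p)) / 2)"
      proof (intro sum_mono)
        fix k show "\<bar>a k\<bar> powr p * \<bar>sqconv A a k\<bar> powr p \<le> (\<bar>a k\<bar> powr (2 * p) + \<bar>sqconv A a k\<bar> powr (2 * p)) / 2"
          using sum_squares_bound[of "\<bar>a k\<bar> powr p" "\<bar>sqconv A a k\<bar> powr p"] by (simp add: dbl)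
      qed
      also have "\<dots> = (Y + (\<Sum>k\<in>A. \<bar>sqconv A a k\<bar> powr (2 * p))) / 2"
        by (simp add: sum_divide_distrib[symmetric] sum.distrib Y_def)
      also have "\<dots> \<le> (Y + \<kappa> powr (2 * p) * Y) / 2"
        unfolding Y_def by (intro divide_right_mono add_left_mono sqconv_bounded A \<kappa>) (use assms in auto)
      finally show "(\<Sum>k\<in>A. \<bar>a k\<bar> powr p * \<bar>sqconv A a k\<bar> powr p) \<le> (1 + \<kappa> powr (2 * p)) / 2 * Y"
        by (simp add: algebra_simps)
    qed (use c in auto)
    also have "\<dots> \<le> \<alpha> * Y + \<beta> * (\<Sum>k\<in>A. \<bar>a k\<bar> powr p * \<bar>b k\<bar> powr p)"
    proof -
      have "1 \<le> c" unfolding c_def using assms by (intro ge_one_powr_ge_zero) auto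
      then have "c * c * 1 \<le> c * c * c" using c by (intro mult_left_mono) auto
      moreover have "0 \<le> Y" unfolding Y_def by (intro sum_nonneg) auto
      ultimately have "c * c * ((1 + \<kappa> powr (2 * p)) / 2 * Y) \<le> c * c * c * ((1 + \<kappa> powr (2 * p)) / 2 * Y)"
        by (intro mult_right_mono[where c = "(1 + \<kappa> powr (2 * p)) / 2 * Y"]) auto
      then show ?thesis by (simp add: \<alpha>_def \<beta>_def algebra_simps)
    qed
    \<comment> \<open>The whole weight \<open>\<beta>\<close> is put on the side of
      \<open>a\<close>, so that exactly half of \<open>X\<close> returns.\<close>
    also have "\<beta> * (\<Sum>k\<in>A. \<bar>a k\<bar> powr p * \<bar>b k\<bar> powr p) \<le> (\<Sum>k\<in>A. (\<beta>\<^sup>2 * \<bar>a k\<bar> powr (2 * p) + \<bar>b k\<bar> powr (2 * p)) / 2)"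
      unfolding sum_distrib_left
    proof (intro sum_mono)
      fix k show "\<beta> * (\<bar>a k\<bar> powr p * \<bar>b k\<bar> powr p) \<le> (\<beta>\<^sup>2 * \<bar>a k\<bar> powr (2 * p) + \<bar>b k\<bar> powr (2 * p)) / 2"
        using sum_squares_bound[of "\<beta> * \<bar>a k\<bar> powr p" "\<bar>b k\<bar> powr p"] by (simp add: dbl power_mult_distrib)
    qed
    also have "\<dots> = (\<beta>\<^sup>2 * Y + X) / 2"
      by (simp add: sum_divide_distrib[symmetric] sum.distrib X_def Y_def sum_distrib_left)
    finally have "X \<le> \<alpha> * Y + (\<beta>\<^sup>2 * Y + X) / 2" by simp
    then have "X \<le> 2 * (\<alpha> * Y) + \<beta>\<^sup>2 * Y" by (simp add: add_divide_distrib)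
    then have "X \<le> (2 * \<alpha> + \<beta>\<^sup>2) * Y" by (simp only: distrib_right mult.assoc)
    then show ?thesis by (simp only: X_def Y_def b_def)
  qed
  moreover have "0 \<le> 2 * \<alpha> + \<beta>\<^sup>2" using c by (simp add: \<alpha>_def)
  ultimately have "hilb_bounded (2 * p) (2 * \<alpha> + \<beta>\<^sup>2)" by (simp add: hilb_bounded_def)
  then show ?thesis ..
qed

lemma hilb_bounded_power_2: "\<exists>C. hilb_bounded (2 ^ Suc r) C"
proof (induction r)
  case 0
  then show ?case using hilb_bounded_2 by simp
next
  case (Suc r)
  then obtain C where C: "hilb_bounded (2 ^ Suc r) C" ..
  have "\<exists>C. hilb_bounded (2 * 2 ^ Suc r) C"
    by (rule hilb_bounded_double[OF _ C]) (rule one_le_power, simp)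
  then show ?case by (simp only: power_Suc)
qed

section \<open>Interpolation by dyadic level sets\<close>

lemma sum_dyadic_ge:
  fixes I :: "int set" and c x :: real
  assumes "finite I" "0 < c" "0 < x"
  shows "(\<Sum>i\<in>{i\<in>I. x \<le> 2 powr i}. 2 powr (- c * i)) \<le> x powr (- c) / (1 - 2 powr (- c))"
proof -
  \<comment> \<open>\<open>i0\<close> is the least exponent with \<open>x \<le> 2 powr i0\<close>:
    the sum is part of a geometric series starting there, whose first term is at most
    \<open>x powr (- c)\<close>.\<close>
  define i0 where "i0 = \<lceil>log 2 x\<rceil>"
  define r where "r = (2::real) powr (- c)"
  have r: "0 < r" "r < 1" using assms by (auto simp: r_def powr_less_one)
  have i0: "i0 \<le> i" if "x \<le> 2 powr i" for i :: int
    using that assms by (simp add: i0_def ceiling_le_iff log_le_iff)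
  let ?J = "{i\<in>I. x \<le> 2 powr i}"
  have "(\<Sum>i\<in>?J. 2 powr (- c * i)) = (\<Sum>i\<in>?J. 2 powr (- c * i0) * r ^ nat (i - i0))"
  proof (intro sum.cong refl)
    fix i assume "i \<in> ?J"
    then have "i0 \<le> i" using i0 by auto
    then have "r ^ nat (i - i0) = 2 powr (- c * (i - i0))"
      using r by (simp add: powr_realpow[symmetric] r_def powr_powr)
    then show "2 powr (- c * i) = 2 powr (- c * i0) * r ^ nat (i - i0)"
      by (simp add: powr_add[symmetric] algebra_simps)
  qed
  also have "\<dots> = 2 powr (- c * i0) * (\<Sum>n\<in>(\<lambda>i. nat (i - i0)) ` ?J. r ^ n)"
    by (subst sum.reindex) (auto simp: inj_on_def sum_distrib_left dest!: i0)
  also have "\<dots> \<le> 2 powr (- c * i0) * (1 / (1 - r))"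
  proof (intro mult_left_mono)
    show "(\<Sum>n\<in>(\<lambda>i. nat (i - i0)) ` ?J. r ^ n) \<le> 1 / (1 - r)"
      using r assms by (subst suminf_geometric[symmetric]) (auto intro!: sum_le_suminf summable_geometric)
  qed auto
  also have "2 powr (- c * i0) \<le> x powr (- c)"
  proof -
    have "x = 2 powr (log 2 x)" using assms by simp
    also have "\<dots> \<le> 2 powr i0" by (simp add: i0_def)
    finally have "(2 powr i0) powr (- c) \<le> x powr (- c)"
      using assms by (intro powr_mono2') auto
    then show ?thesis by (simp add: powr_powr mult.commute)
  qed
  finally show ?thesis using r by (simp add: r_def divide_right_mono mult_right_mono)
qed

lemma sum_dyadic_less:
  fixes I :: "int set" and c x :: real
  assumes "finite I" "0 < c" "0 < x"
  shows "(\<Sum>i\<in>{i\<in>I. 2 powr i < x}. 2 powr (c * i)) \<le> x powr c / (1 - 2 powr (- c))"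
proof -
  have "(\<Sum>i\<in>{i\<in>I. 2 powr i < x}. 2 powr (c * i)) = (\<Sum>i\<in>(uminus :: int \<Rightarrow> int) ` {i\<in>I. 2 powr i < x}. 2 powr (- c * i))"
    by (subst sum.reindex) (auto simp: inj_on_def)
  also have "\<dots> \<le> (\<Sum>i\<in>{i\<in>uminus ` I. inverse x \<le> 2 powr i}. 2 powr (- c * i))"
    using assms by (intro sum_mono2) (auto simp: powr_minus intro!: le_imp_inverse_le)
  also have "\<dots> \<le> inverse x powr (- c) / (1 - 2 powr (- c))"
    using assms by (intro sum_dyadic_ge) auto
  finally show ?thesis using assms by (simp add: powr_minus inverse_powr)
qed

text \<open>Chebyshev's inequality: interpolation uses the endpoint bounds only in this weak
  form.\<close>

lemma hilb_level_count:
  assumes "hilb_bounded s C" "finite A" "0 < t" "0 < s"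
  shows "real (card {k\<in>A. t < \<bar>hilb A a k\<bar>}) \<le> C * t powr (- s) * (\<Sum>k\<in>A. \<bar>a k\<bar> powr s)"
proof -
  have "t powr s * real (card {k\<in>A. t < \<bar>hilb A a k\<bar>}) = (\<Sum>k\<in>{k\<in>A. t < \<bar>hilb A a k\<bar>}. t powr s)" by simp
  also have "\<dots> \<le> (\<Sum>k\<in>{k\<in>A. t < \<bar>hilb A a k\<bar>}. \<bar>hilb A a k\<bar> powr s)"
    using assms by (intro sum_mono powr_mono2) auto
  also have "\<dots> \<le> (\<Sum>k\<in>A. \<bar>hilb A a k\<bar> powr s)"
    using assms by (intro sum_mono2) auto
  also have "\<dots> \<le> C * (\<Sum>k\<in>A. \<bar>a k\<bar> powr s)"
    using assms by (simp add: hilb_bounded_def)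
  finally show ?thesis using assms by (simp add: powr_minus field_simps)
qed

text \<open>Marcinkiewicz interpolation between the exponents 2 and \<open>s\<close>, truncating at the levels \<open>2\<^sup>i\<close>.\<close>

lemma hilb_bounded_interpolate:
  assumes "hilb_bounded 2 C2" "hilb_bounded s Cs" "2 < p" "p < s"
  shows "\<exists>C. hilb_bounded p C"
proof -
  \<comment> \<open>In both constants \<open>2 powr p\<close> pays for the upper end of a dyadic
    level, the next factors come from Chebyshev at half the level, and the denominator is that of a
    geometric series.\<close>
  define \<gamma> where "\<gamma> = 2 powr p * (2 powr s * Cs / (1 - 2 powr (- (s - p))))"
  define \<delta> where "\<delta> = 2 powr p * (2 powr 2 * C2 / (1 - 2 powr (- (p - 2))))"
  have C0: "0 \<le> C2" "0 \<le> Cs" using assms by (auto simp: hilb_bounded_def)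
  have lt1: "2 powr (- (s - p)) < (1::real)" "2 powr (- (p - 2)) < (1::real)"
    using assms by (auto simp: powr_less_one)
  have pos: "0 \<le> \<gamma>" "0 \<le> \<delta>" using C0 lt1 by (auto simp: \<gamma>_def \<delta>_def)
  have "(\<Sum>k\<in>A. \<bar>hilb A a k\<bar> powr p) \<le> (\<gamma> + \<delta>) * (\<Sum>k\<in>A. \<bar>a k\<bar> powr p)" if A: "finite A" for A a
  proof -
    define b where "b = hilb A a"
    \<comment> \<open>Ceiling minus one, rather than floor, makes the lower inequality strict, to
      match the strict level sets below.\<close>
    define lev where "lev = (\<lambda>k. \<lceil>log 2 \<bar>b k\<bar>\<rceil> - 1)"
    define B where "B = {k\<in>A. b k \<noteq> 0}"
    define I where "I = lev ` B"
    have finI: "finite I" "finite B" using A by (auto simp: I_def B_def)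
    \<comment> \<open>The bounded part \<open>lo\<close> is measured with the exponent
      \<open>s\<close>, the large part \<open>hi\<close> with the exponent 2.\<close>
    define lo where "lo = (\<lambda>(i::int) j. if \<bar>a j\<bar> \<le> 2 powr i then a j else 0)"
    define hi where "hi = (\<lambda>(i::int) j. if \<bar>a j\<bar> \<le> 2 powr i then 0 else a j)"
    have lev: "2 powr lev k < \<bar>b k\<bar>" "\<bar>b k\<bar> \<le> 2 powr (lev k + 1)" if "k \<in> B" for k
    proof -
      have b: "0 < \<bar>b k\<bar>" using that by (simp add: B_def)
      have "lev k < log 2 \<bar>b k\<bar>" unfolding lev_def by linarith
      then show "2 powr lev k < \<bar>b k\<bar>" using b by (simp add: less_log_iff)
      have "log 2 \<bar>b k\<bar> \<le> lev k + 1" unfolding lev_def by linarith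
      then show "\<bar>b k\<bar> \<le> 2 powr (lev k + 1)" using b by (simp add: log_le_iff)
    qed
    have cnt: "real (card {k\<in>A. 2 powr i < \<bar>b k\<bar>})
        \<le> 2 powr s * Cs * (2 powr (- s * i) * (\<Sum>k\<in>A. \<bar>lo i k\<bar> powr s))
          + 2 powr 2 * C2 * (2 powr (- 2 * real_of_int i) * (\<Sum>k\<in>A. \<bar>hi i k\<bar> powr 2))" for i
    proof -
      \<comment> \<open>If a sum exceeds \<open>2 powr i\<close>, one of its two terms exceeds half
        of that.\<close>
      let ?t = "2 powr (i - 1) :: real"
      have "b k = hilb A (lo i) k + hilb A (hi i) k" for k
        unfolding hilb_add[symmetric] b_def by (rule arg_cong[where f = "\<lambda>f. hilb A f k"]) (auto simp: lo_def hi_def)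
      moreover have "2 powr i = ?t + ?t" by (simp add: powr_diff)
      ultimately have "{k\<in>A. 2 powr i < \<bar>b k\<bar>} \<subseteq> {k\<in>A. ?t < \<bar>hilb A (lo i) k\<bar>} \<union> {k\<in>A. ?t < \<bar>hilb A (hi i) k\<bar>}"
        by auto
      then have "card {k\<in>A. 2 powr i < \<bar>b k\<bar>} \<le> card ({k\<in>A. ?t < \<bar>hilb A (lo i) k\<bar>} \<union> {k\<in>A. ?t < \<bar>hilb A (hi i) k\<bar>})"
        using A by (intro card_mono) auto
      also have "\<dots> \<le> card {k\<in>A. ?t < \<bar>hilb A (lo i) k\<bar>} + card {k\<in>A. ?t < \<bar>hilb A (hi i) k\<bar>}"
        by (rule card_Un_le)
      finally have "real (card {k\<in>A. 2 powr i < \<bar>b k\<bar>}) \<le> real (card {k\<in>A. ?t < \<bar>hilb A (lo i) k\<bar>}) + real (card {k\<in>A. ?t < \<bar>hilb A (hi i) k\<bar>})"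
        by linarith
      also have "\<dots> \<le> Cs * ?t powr (- s) * (\<Sum>k\<in>A. \<bar>lo i k\<bar> powr s) + C2 * ?t powr (- 2) * (\<Sum>k\<in>A. \<bar>hi i k\<bar> powr 2)"
        by (intro add_mono hilb_level_count assms A) (use assms in auto)
      also have "?t powr (- s) = 2 powr s * 2 powr (- s * i)"
        unfolding powr_powr powr_add[symmetric] by (rule arg_cong[where f = "(powr) 2"]) (simp add: algebra_simps)
      also have "?t powr (- 2) = 2 powr 2 * 2 powr (- 2 * real_of_int i)"
        unfolding powr_powr powr_add[symmetric] by (rule arg_cong[where f = "(powr) 2"]) (simp add: algebra_simps)
      finally show ?thesis by (simp only: mult_ac)
    qed
    have "(\<Sum>k\<in>A. \<bar>b k\<bar> powr p) = (\<Sum>k\<in>B. \<bar>b k\<bar> powr p)"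
      using A by (intro sum.mono_neutral_right) (auto simp: B_def)
    \<comment> \<open>A discrete layer-cake bound: the single level \<open>i = lev k\<close> already
      dominates the left side, and the other levels add nonnegative terms.\<close>
    also have "\<dots> \<le> (\<Sum>k\<in>B. \<Sum>i\<in>I. if 2 powr i < \<bar>b k\<bar> then 2 powr (p * (i + 1)) else 0)"
    proof (intro sum_mono)
      fix k assume k: "k \<in> B"
      have "\<bar>b k\<bar> powr p \<le> (2 powr (lev k + 1)) powr p"
        using lev(2)[OF k] assms by (intro powr_mono2) auto
      also have "\<dots> = (if 2 powr lev k < \<bar>b k\<bar> then 2 powr (p * (lev k + 1)) else 0)"
        using lev(1)[OF k] by (simp add: powr_powr mult.commute)
      also have "\<dots> \<le> (\<Sum>i\<in>I. if 2 powr i < \<bar>b k\<bar> then 2 powr (p * (i + 1)) else 0)"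
        using k finI by (intro member_le_sum) (auto simp: I_def)
      finally show "\<bar>b k\<bar> powr p \<le> (\<Sum>i\<in>I. if 2 powr i < \<bar>b k\<bar> then 2 powr (p * (i + 1)) else 0)" .
    qed
    also have "\<dots> = (\<Sum>i\<in>I. \<Sum>k\<in>{k\<in>B. 2 powr i < \<bar>b k\<bar>}. 2 powr (p * (i + 1)))"
      by (subst sum.swap) (simp only: sum.inter_filter finI)
    also have "\<dots> \<le> (\<Sum>i\<in>I. 2 powr (p * (i + 1)) * real (card {k\<in>A. 2 powr i < \<bar>b k\<bar>}))"
    proof (intro sum_mono)
      fix i :: int
      have "card {k\<in>B. 2 powr i < \<bar>b k\<bar>} \<le> card {k\<in>A. 2 powr i < \<bar>b k\<bar>}"
        using A by (intro card_mono) (auto simp: B_def)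
      then show "(\<Sum>k\<in>{k\<in>B. 2 powr i < \<bar>b k\<bar>}. 2 powr (p * (i + 1))) \<le> 2 powr (p * (i + 1)) * real (card {k\<in>A. 2 powr i < \<bar>b k\<bar>})"
        by (simp add: mult.commute mult_left_mono)
    qed
    also have "\<dots> \<le> (\<Sum>i\<in>I. 2 powr (p * (i + 1)) *
         (2 powr s * Cs * (2 powr (- s * i) * (\<Sum>k\<in>A. \<bar>lo i k\<bar> powr s))
          + 2 powr 2 * C2 * (2 powr (- 2 * real_of_int i) * (\<Sum>k\<in>A. \<bar>hi i k\<bar> powr 2))))"
      by (intro sum_mono mult_left_mono cnt) auto
    also have "\<dots> = 2 powr p * (2 powr s * Cs * (\<Sum>k\<in>A. \<Sum>i\<in>I. 2 powr (- (s - p) * i) * \<bar>lo i k\<bar> powr s)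
         + 2 powr 2 * C2 * (\<Sum>k\<in>A. \<Sum>i\<in>I. 2 powr ((p - 2) * i) * \<bar>hi i k\<bar> powr 2))"
    proof -
      have e: "2 powr (p * (i + 1)) * (x * (2 powr (- s * i) * y) + z * (2 powr (- 2 * real_of_int i) * w))
        = 2 powr p * (x * (2 powr (- (s - p) * i) * y) + z * (2 powr ((p - 2) * i) * w))" for i :: int and x y z w :: real
      proof -
        have 1: "2 powr (p * (i + 1)) = (2 powr p * 2 powr (p * i) :: real)"
          by (simp add: powr_add[symmetric] algebra_simps)
        have 2: "2 powr (- (s - p) * i) = (2 powr (p * i) * 2 powr (- s * i) :: real)"
           "2 powr ((p - 2) * i) = (2 powr (p * i) * 2 powr (- 2 * real_of_int i) :: real)"
          by (simp_all only: powr_add[symmetric] algebra_simps) (simp_all add: algebra_simps)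
        show ?thesis unfolding 1 2 by (simp only: algebra_simps)
      qed
      show ?thesis unfolding e
        by (subst (1 2) sum.swap) (simp only: sum.distrib sum_distrib_left distrib_left)
    qed
    \<comment> \<open>For fixed \<open>k\<close>, \<open>lo\<close> only sees levels from
      \<open>\<bar>a k\<bar>\<close> upwards, where the weights decay because \<open>p < s\<close>;
      \<open>hi\<close> only sees levels below, where they grow because \<open>2 < p\<close>. Both
      series are governed by the level of \<open>\<bar>a k\<bar>\<close>.\<close>
    also have "\<dots> \<le> 2 powr p * (2 powr s * Cs * (\<Sum>k\<in>A. \<bar>a k\<bar> powr p / (1 - 2 powr (- (s - p))))
         + 2 powr 2 * C2 * (\<Sum>k\<in>A. \<bar>a k\<bar> powr p / (1 - 2 powr (- (p - 2)))))"
    proof (intro mult_left_mono add_mono sum_mono)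
      fix k
      show "(\<Sum>i\<in>I. 2 powr (- (s - p) * i) * \<bar>lo i k\<bar> powr s) \<le> \<bar>a k\<bar> powr p / (1 - 2 powr (- (s - p)))"
      proof (cases "a k = 0")
        case False
        have "(\<Sum>i\<in>I. 2 powr (- (s - p) * i) * \<bar>lo i k\<bar> powr s) 
            = (\<Sum>i\<in>{i\<in>I. \<bar>a k\<bar> \<le> 2 powr i}. 2 powr (- (s - p) * i)) * \<bar>a k\<bar> powr s"
          unfolding lo_def sum_distrib_right using finI by (simp add: sum.inter_filter if_distrib if_distribR cong: if_cong)
        also have "\<dots> \<le> \<bar>a k\<bar> powr (- (s - p)) / (1 - 2 powr (- (s - p))) * \<bar>a k\<bar> powr s"
          by (intro mult_right_mono sum_dyadic_ge) (use assms finI False in auto)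
        also have "\<dots> = \<bar>a k\<bar> powr p / (1 - 2 powr (- (s - p)))"
          by (simp add: powr_add[symmetric])
        finally show ?thesis .
      qed (simp add: lo_def)
      show "(\<Sum>i\<in>I. 2 powr ((p - 2) * i) * \<bar>hi i k\<bar> powr 2) \<le> \<bar>a k\<bar> powr p / (1 - 2 powr (- (p - 2)))"
      proof (cases "a k = 0")
        case False
        have "(\<Sum>i\<in>I. 2 powr ((p - 2) * i) * \<bar>hi i k\<bar> powr 2) 
            = (\<Sum>i\<in>I. if 2 powr i < \<bar>a k\<bar> then 2 powr ((p - 2) * i) * \<bar>a k\<bar> powr 2 else 0)"
          by (intro sum.cong) (auto simp: hi_def)
        also have "\<dots> = (\<Sum>i\<in>{i\<in>I. 2 powr i < \<bar>a k\<bar>}. 2 powr ((p - 2) * i)) * \<bar>a k\<bar> powr 2"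
          unfolding sum_distrib_right by (simp only: sum.inter_filter finI)
        also have "\<dots> \<le> \<bar>a k\<bar> powr (p - 2) / (1 - 2 powr (- (p - 2))) * \<bar>a k\<bar> powr 2"
          by (intro mult_right_mono sum_dyadic_less) (use assms finI False in auto)
        also have "\<dots> = \<bar>a k\<bar> powr (p - 2) * \<bar>a k\<bar> powr 2 / (1 - 2 powr (- (p - 2)))" by simp
        also have "\<dots> = \<bar>a k\<bar> powr p / (1 - 2 powr (- (p - 2)))"
          unfolding powr_add[symmetric] by simp
        finally show ?thesis .
      qed (simp add: hi_def)
    qed (use C0 in auto)
    also have "\<dots> = (\<gamma> + \<delta>) * (\<Sum>k\<in>A. \<bar>a k\<bar> powr p)"
      by (simp add: \<gamma>_def \<delta>_def sum_divide_distrib[symmetric] algebra_simps)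
    finally show ?thesis by (simp add: b_def)
  qed
  then have "hilb_bounded p (\<gamma> + \<delta>)" using pos by (simp add: hilb_bounded_def)
  then show ?thesis ..
qed

section \<open>Duality, and passage to complex sequences\<close>

lemma hilb_bounded_dual:
  assumes "1 < p" "1 < q" "1 / p + 1 / q = 1" "hilb_bounded q C"
  shows "\<exists>C'. hilb_bounded p C'"
proof -
  have C: "0 \<le> C" using assms by (simp add: hilb_bounded_def)
  \<comment> \<open>Chosen so that \<open>\<epsilon> powr q / q * (C + 1) = 1 / 2\<close>;
    \<open>C + 1\<close> in place of \<open>C\<close> keeps the denominator positive.\<close>
  define \<epsilon> where "\<epsilon> = (q / (2 * (C + 1))) powr (1 / q)"
  have q: "0 < q / (2 * (C + 1))" using C assms by simp
  then have \<epsilon>: "0 < \<epsilon>" using C assms by (simp add: \<epsilon>_def)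
  have \<epsilon>q: "\<epsilon> powr q = q / (2 * (C + 1))"
    using assms q C by (simp add: \<epsilon>_def powr_powr)
  have pq: "(p - 1) * q = p" using assms by (simp add: field_simps)
  have "(\<Sum>k\<in>A. \<bar>hilb A a k\<bar> powr p) \<le> 2 * \<epsilon> powr (- p) / p * (\<Sum>k\<in>A. \<bar>a k\<bar> powr p)" if A: "finite A" for A a
  proof -
    define b where "b = hilb A a"
    \<comment> \<open>The extremal test sequence: \<open>w k * b k\<close> is
      \<open>\<bar>b k\<bar> powr p\<close>, and so is \<open>\<bar>w k\<bar> powr q\<close>.
      Antisymmetry moves the transform onto \<open>w\<close>, where the bound for \<open>q\<close>
      applies; Young's inequality with the weight \<open>\<epsilon>\<close> then returns only half
      of \<open>X\<close>.\<close>
    define w where "w = (\<lambda>k. sgn (b k) * \<bar>b k\<bar> powr (p - 1))"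
    define X where "X = (\<Sum>k\<in>A. \<bar>b k\<bar> powr p)"
    have wq: "\<bar>w k\<bar> powr q = \<bar>b k\<bar> powr p" for k
      by (simp add: w_def abs_mult powr_powr pq abs_sgn_eq)
    have "X = (\<Sum>k\<in>A. w k * b k)"
      unfolding X_def
    proof (intro sum.cong refl)
      fix k
      have "w k * b k = \<bar>b k\<bar> powr (p - 1) * \<bar>b k\<bar>" by (simp add: w_def abs_sgn mult_ac)
      also have "\<dots> = \<bar>b k\<bar> powr p" by (cases "b k = 0") (simp_all add: powr_diff)
      finally show "\<bar>b k\<bar> powr p = w k * b k" by simp
    qed
    also have "\<dots> = - (\<Sum>j\<in>A. a j * hilb A w j)" unfolding b_def by (rule hilb_antisym)
    also have "\<dots> \<le> (\<Sum>j\<in>A. \<epsilon> powr (- p) / p * \<bar>a j\<bar> powr p + \<epsilon> powr q / q * \<bar>hilb A w j\<bar> powr q)"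
      unfolding sum_negf[symmetric]
    proof (intro sum_mono)
      fix j
      have "- (a j * hilb A w j) \<le> \<bar>a j * hilb A w j\<bar>" by simp
      also have "\<dots> = (\<bar>a j\<bar> / \<epsilon>) * (\<epsilon> * \<bar>hilb A w j\<bar>)" using \<epsilon> by (simp add: abs_mult)
      also have "\<dots> \<le> (\<bar>a j\<bar> / \<epsilon>) powr p / p + (\<epsilon> * \<bar>hilb A w j\<bar>) powr q / q"
        by (rule Youngs_inequality) (use assms \<epsilon> in auto)
      also have "\<dots> = \<epsilon> powr (- p) / p * \<bar>a j\<bar> powr p + \<epsilon> powr q / q * \<bar>hilb A w j\<bar> powr q"
        using \<epsilon> by (simp add: powr_mult powr_divide powr_minus field_simps)
      finally show "- (a j * hilb A w j) \<le> \<epsilon> powr (- p) / p * \<bar>a j\<bar> powr p + \<epsilon> powr q / q * \<bar>hilb A w j\<bar> powr q" .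
    qed
    also have "\<dots> = \<epsilon> powr (- p) / p * (\<Sum>j\<in>A. \<bar>a j\<bar> powr p) + \<epsilon> powr q / q * (\<Sum>j\<in>A. \<bar>hilb A w j\<bar> powr q)"
      by (simp add: sum.distrib sum_distrib_left)
    also have "(\<Sum>j\<in>A. \<bar>hilb A w j\<bar> powr q) \<le> C * (\<Sum>j\<in>A. \<bar>w j\<bar> powr q)"
      using assms(4) A by (simp add: hilb_bounded_def)
    also have "C * (\<Sum>j\<in>A. \<bar>w j\<bar> powr q) \<le> (C + 1) * X"
      unfolding wq X_def by (intro mult_right_mono sum_nonneg) auto
    also have "\<epsilon> powr q / q * ((C + 1) * X) = X / 2"
    proof -
      have "q / (2 * D) / q * (D * X) = X / 2" if "0 < D" for D
        using assms that by simp
      from this[of "C + 1"] show ?thesis using C unfolding \<epsilon>q by linarith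
    qed
    finally have "X \<le> \<epsilon> powr (- p) / p * (\<Sum>j\<in>A. \<bar>a j\<bar> powr p) + X / 2"
      using assms by (simp add: mult_left_mono divide_right_mono)
    then show ?thesis by (simp add: X_def b_def)
  qed
  then have "hilb_bounded p (2 * \<epsilon> powr (- p) / p)" using assms by (simp add: hilb_bounded_def)
  then show ?thesis ..
qed

lemma hilb_bounded_exists:
  assumes "1 < p"
  shows "\<exists>C. hilb_bounded p C"
proof -
  have gt2: "\<exists>C. hilb_bounded q C" if "2 < q" for q
  proof -
    obtain r where "q < 2 ^ r" using real_arch_pow[of 2 q] by auto
    also have "(2::real) ^ r < 2 ^ Suc r" by simp
    finally have "q < 2 ^ Suc r" .
    moreover obtain C2 where "hilb_bounded 2 C2" using hilb_bounded_2 ..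
    moreover obtain Cs where "hilb_bounded (2 ^ Suc r) Cs" using hilb_bounded_power_2 ..
    ultimately show ?thesis using that hilb_bounded_interpolate by blast
  qed
  consider "p < 2" | "p = 2" | "2 < p" by linarith
  then show ?thesis
  proof cases
    case 1
    define q where "q = p / (p - 1)"
    have "2 < q" "1 < q" "1 / p + 1 / q = 1" using assms 1 by (auto simp: q_def field_simps)
    then show ?thesis using gt2[of q] hilb_bounded_dual[OF assms] by blast
  qed (use gt2 hilb_bounded_2 in auto)
qed

text \<open>Extension by zero to \<open>J \<union> B\<close> permits different sets of inputs and
  outputs. Real and imaginary parts are estimated separately: \<open>2 powr p\<close> splits them,
  and the factor 2 is for bounding each by the modulus.\<close>

lemma hilb_bounded_complex:
  fixes a :: "int \<Rightarrow> complex"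
  assumes "hilb_bounded p C" "0 < p" "finite J" "finite B"
  shows "(\<Sum>k\<in>B. cmod (\<Sum>j\<in>J. a j / of_int (k - j)) powr p) \<le> 2 powr p * (2 * C) * (\<Sum>j\<in>J. cmod (a j) powr p)"
proof -
  have C: "0 \<le> C" using assms by (simp add: hilb_bounded_def)
  define H where "H = (\<lambda>u k. \<Sum>j\<in>J. u j / of_int (k - j) :: real)"
  have real_case: "(\<Sum>k\<in>B. \<bar>H u k\<bar> powr p) \<le> C * (\<Sum>j\<in>J. \<bar>u j\<bar> powr p)" for u
  proof -
    define v where "v = (\<lambda>j. if j \<in> J then u j else 0)"
    have fin: "finite (J \<union> B)" using assms by simp
    have "hilb (J \<union> B) v k = H u k" for k
      unfolding hilb_def H_def by (rule sum.mono_neutral_cong_right) (use assms in \<open>auto simp: v_def\<close>)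
    then have "(\<Sum>k\<in>B. \<bar>H u k\<bar> powr p) = (\<Sum>k\<in>B. \<bar>hilb (J \<union> B) v k\<bar> powr p)" by simp
    also have "\<dots> \<le> (\<Sum>k\<in>J \<union> B. \<bar>hilb (J \<union> B) v k\<bar> powr p)"
      using fin by (intro sum_mono2) auto
    also have "\<dots> \<le> C * (\<Sum>k\<in>J \<union> B. \<bar>v k\<bar> powr p)"
      using assms(1) fin unfolding hilb_bounded_def by blast
    also have "(\<Sum>k\<in>J \<union> B. \<bar>v k\<bar> powr p) = (\<Sum>j\<in>J. \<bar>u j\<bar> powr p)"
      by (rule sum.mono_neutral_cong_right) (use assms in \<open>auto simp: v_def\<close>)
    finally show ?thesis .
  qed
  have "(\<Sum>k\<in>B. cmod (\<Sum>j\<in>J. a j / of_int (k - j)) powr p)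
     \<le> (\<Sum>k\<in>B. 2 powr p * (\<bar>H (\<lambda>j. Re (a j)) k\<bar> powr p + \<bar>H (\<lambda>j. Im (a j)) k\<bar> powr p))"
  proof (intro sum_mono)
    fix k
    have ri: "Re (a j / of_int (k - j)) = Re (a j) / of_int (k - j)" "Im (a j / of_int (k - j)) = Im (a j) / of_int (k - j)" for j
      using Re_divide_of_real[of "a j" "of_int (k - j)"] Im_divide_of_real[of "a j" "of_int (k - j)"] by simp_all
    have "cmod (\<Sum>j\<in>J. a j / of_int (k - j)) \<le> \<bar>H (\<lambda>j. Re (a j)) k\<bar> + \<bar>H (\<lambda>j. Im (a j)) k\<bar>"
      using cmod_le[of "\<Sum>j\<in>J. a j / of_int (k - j)"] unfolding Re_sum Im_sum ri H_def .
    then have "cmod (\<Sum>j\<in>J. a j / of_int (k - j)) powr p \<le> (\<bar>H (\<lambda>j. Re (a j)) k\<bar> + \<bar>H (\<lambda>j. Im (a j)) k\<bar>) powr p"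
      using assms by (intro powr_mono2) auto
    also have "\<dots> \<le> 2 powr p * (\<bar>H (\<lambda>j. Re (a j)) k\<bar> powr p + \<bar>H (\<lambda>j. Im (a j)) k\<bar> powr p)"
      using assms by (intro powr_add_le) auto
    finally show "cmod (\<Sum>j\<in>J. a j / of_int (k - j)) powr p
      \<le> 2 powr p * (\<bar>H (\<lambda>j. Re (a j)) k\<bar> powr p + \<bar>H (\<lambda>j. Im (a j)) k\<bar> powr p)" .
  qed
  also have "\<dots> = 2 powr p * ((\<Sum>k\<in>B. \<bar>H (\<lambda>j. Re (a j)) k\<bar> powr p) + (\<Sum>k\<in>B. \<bar>H (\<lambda>j. Im (a j)) k\<bar> powr p))"
    by (simp add: sum_distrib_left sum.distrib distrib_left)
  also have "\<dots> \<le> 2 powr p * (C * (\<Sum>j\<in>J. \<bar>Re (a j)\<bar> powr p) + C * (\<Sum>j\<in>J. \<bar>Im (a j)\<bar> powr p))"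
    by (intro mult_left_mono add_mono real_case) auto
  also have "\<dots> \<le> 2 powr p * (C * (\<Sum>j\<in>J. cmod (a j) powr p) + C * (\<Sum>j\<in>J. cmod (a j) powr p))"
    using C assms by (intro mult_left_mono add_mono sum_mono powr_mono2 abs_Re_le_cmod abs_Im_le_cmod) auto
  finally show ?thesis by (simp add: algebra_simps)
qed

section \<open>Discrete holomorphic functions with bounded rows\<close>

definition disc_hol :: "(int \<Rightarrow> nat \<Rightarrow> complex) \<Rightarrow> bool" where
  "disc_hol F \<longleftrightarrow> (\<forall>m n. F m n + \<i> * F (m + 1) n - F (m + 1) (Suc n) - \<i> * F m (Suc n) = 0)"

text \<open>\<open>M\<close> stands for the p-th power of a bound on the H^p norm; finite partial
  sums carry the summability along.\<close>

definition rows_bounded :: "real \<Rightarrow> (int \<Rightarrow> nat \<Rightarrow> complex) \<Rightarrow> real \<Rightarrow> bool" where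
  "rows_bounded p F M \<longleftrightarrow> (\<forall>n B. finite B \<longrightarrow> (\<Sum>m\<in>B. cmod (F m n) powr p) \<le> M)"

text \<open>The equations of the four unit squares around the point, taken with the weights
  \<open>\<i>\<close>, \<open>-1\<close>, \<open>1\<close>, \<open>-\<i>\<close>, lose all
  horizontal and vertical neighbours.\<close>

lemma disc_hol_harmonic:
  assumes "disc_hol F"
  shows "F m (Suc n) = (F (m - 1) n + F (m + 1) n + F (m - 1) (Suc (Suc n)) + F (m + 1) (Suc (Suc n))) / 4"
proof -
  have "F m n + \<i> * F (m + 1) n - F (m + 1) (Suc n) - \<i> * F m (Suc n) = 0"
    "F (m - 1) n + \<i> * F m n - F m (Suc n) - \<i> * F (m - 1) (Suc n) = 0"
    "F m (Suc n) + \<i> * F (m + 1) (Suc n) - F (m + 1) (Suc (Suc n)) - \<i> * F m (Suc (Suc n)) = 0"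
    "F (m - 1) (Suc n) + \<i> * F m (Suc n) - F m (Suc (Suc n)) - \<i> * F (m - 1) (Suc (Suc n)) = 0"
    using assms[unfolded disc_hol_def, rule_format, of m n]
      assms[unfolded disc_hol_def, rule_format, of "m - 1" n]
      assms[unfolded disc_hol_def, rule_format, of m "Suc n"]
      assms[unfolded disc_hol_def, rule_format, of "m - 1" "Suc n"] by simp_all
  moreover have "\<i> * \<i> = -1" by simp
  ultimately have "4 * F m (Suc n) = F (m - 1) n + F (m + 1) n + F (m - 1) (Suc (Suc n)) + F (m + 1) (Suc (Suc n))"
    by algebra
  then show ?thesis by (simp add: eq_divide_eq mult.commute)
qed

lemma powr_mean_le:
  fixes x y p :: real
  assumes "1 \<le> p" "0 \<le> x" "0 \<le> y"
  shows "((x + y) / 2) powr p \<le> (x powr p + y powr p) / 2"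
  using convex_onD[OF convex_on_powr_nonneg[OF assms(1)], of "1 / 2" x y] assms
  by (simp add: add_divide_distrib)

lemma norm_mean4_powr_le:
  fixes a b c d :: complex
  assumes "1 \<le> p"
  shows "cmod ((a + b + c + d) / 4) powr p \<le> (cmod a powr p + cmod b powr p + cmod c powr p + cmod d powr p) / 4"
proof -
  have "cmod (a + b + c + d) \<le> cmod a + cmod b + (cmod c + cmod d)"
    using norm_triangle_ineq[of "a + b" "c + d"] norm_triangle_ineq[of a b] norm_triangle_ineq[of c d]
    unfolding add.assoc by linarith
  then have "cmod (a + b + c + d) / 4 \<le> (cmod a + cmod b + (cmod c + cmod d)) / 4"
    by (rule divide_right_mono) simp
  then have "cmod ((a + b + c + d) / 4) \<le> ((cmod a + cmod b) / 2 + (cmod c + cmod d) / 2) / 2"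
    by (simp only: norm_divide) (simp add: add_divide_distrib)
  then have "cmod ((a + b + c + d) / 4) powr p \<le> (((cmod a + cmod b) / 2 + (cmod c + cmod d) / 2) / 2) powr p"
    using assms by (intro powr_mono2) auto
  also have "\<dots> \<le> (((cmod a + cmod b) / 2) powr p + ((cmod c + cmod d) / 2) powr p) / 2"
    using assms by (intro powr_mean_le) auto
  also have "\<dots> \<le> ((cmod a powr p + cmod b powr p) / 2 + (cmod c powr p + cmod d powr p) / 2) / 2"
    using assms by (intro divide_right_mono add_mono powr_mean_le) auto
  finally show ?thesis by (simp add: add_divide_distrib)
qed

text \<open>The increments increase, so a positive one would force linear growth.\<close>

lemma bounded_convex_seq_le:
  fixes T :: "nat \<Rightarrow> real"
  assumes convex: "\<And>n. T (Suc n) \<le> (T n + T (Suc (Suc n))) / 2" and bdd: "\<And>n. T n \<le> M"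
  shows "T n \<le> T 0"
proof -
  define d where "d n = T (Suc n) - T n" for n
  have "incseq d" by (rule incseq_SucI) (use convex in \<open>simp add: d_def field_simps\<close>)
  have "d n \<le> 0" for n
  proof (rule ccontr)
    assume pos: "\<not> d n \<le> 0"
    have grow: "T n + real k * d n \<le> T (n + k)" for k
    proof (induction k)
      case (Suc k)
      have "d n \<le> d (n + k)" using \<open>incseq d\<close> by (simp add: incseq_def)
      then show ?case using Suc by (simp add: d_def algebra_simps)
    qed simp
    obtain k where "(M - T n) < real k * d n" using pos reals_Archimedean3[of "d n"] by force
    then show False using grow[of k] bdd[of "n + k"] by linarith
  qed
  then have "decseq T" by (intro decseq_SucI) (simp add: d_def)
  then show ?thesis by (simp add: decseq_def)
qed

text \<open>A bound on one class of boundary points passes to all rows of that class without loss.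
  \<open>M\<close> serves to exclude growth of the row sums and leaves no trace in the conclusion,
  so it may vary along a sequence of functions.\<close>

lemma parity_class_row_le:
  assumes "1 \<le> p" and hol: "disc_hol F" and bdd: "rows_bounded p F M"
    and A: "\<And>B. \<lbrakk>finite B; B \<subseteq> {m. even (m + c)}\<rbrakk> \<Longrightarrow> (\<Sum>m\<in>B. cmod (F m 0) powr p) \<le> A"
    and B: "finite B" "B \<subseteq> {m. even (m + int n + c)}"
  shows "(\<Sum>m\<in>B. cmod (F m n) powr p) \<le> A"
proof -
  define R where "R n = {m. even (m + int n + c)}" for n
  define g where "g n m = cmod (F m n) powr p" for n m
  define T where "T n = infsum (g n) (R n)" for n
  have fin: "sum (g n) B \<le> M" if "finite B" for n B
    using bdd that unfolding rows_bounded_def g_def by blast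
  have summ: "g n summable_on R n" for n
    by (rule nonneg_bdd_above_summable_on) (auto simp: g_def[abs_def] bdd_above_def intro!: exI[of _ M] fin[unfolded g_def])
  have hs: "(g n has_sum T n) (R n)" for n unfolding T_def using summ by (rule has_sum_infsum)
  \<comment> \<open>Diagonal neighbours stay in the class: a horizontal step by one maps its row
    \<open>n\<close> onto its row \<open>k\<close> if \<open>n\<close> and \<open>k\<close> differ
    in parity.\<close>
  have shift: "((\<lambda>m. g k (m + s)) has_sum T k) (R n)" if "\<bar>s\<bar> = 1" "odd (int n + int k)" for k n s
  proof -
    have "bij_betw (\<lambda>m. m + s) (R n) (R k)"
      by (rule bij_betwI[of _ _ _ "\<lambda>m. m - s"]) (use that in \<open>auto simp: R_def abs_if split: if_splits\<close>)
    from has_sum_reindex_bij_betw[OF this, of "g k" "T k"] show ?thesis using hs by simp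
  qed
  have "T (Suc n) \<le> (T n + T (Suc (Suc n))) / 2" for n
  proof -
    have "((\<lambda>m. (g n (m + - 1) + g n (m + 1) + g (Suc (Suc n)) (m + - 1) + g (Suc (Suc n)) (m + 1)) * (1 / 4))
        has_sum (T n + T n + T (Suc (Suc n)) + T (Suc (Suc n))) * (1 / 4)) (R (Suc n))"
      by (intro has_sum_cmult_left has_sum_add shift) auto
    moreover have "g (Suc n) m \<le> (g n (m + - 1) + g n (m + 1) + g (Suc (Suc n)) (m + - 1) + g (Suc (Suc n)) (m + 1)) * (1 / 4)" for m
      using norm_mean4_powr_le[OF assms(1), of "F (m - 1) n" "F (m + 1) n" "F (m - 1) (Suc (Suc n))" "F (m + 1) (Suc (Suc n))"]
      unfolding g_def by (subst disc_hol_harmonic[OF hol]) simp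
    ultimately have "T (Suc n) \<le> (T n + T n + T (Suc (Suc n)) + T (Suc (Suc n))) * (1 / 4)"
      by (rule has_sum_mono[OF hs])
    then show ?thesis by simp
  qed
  moreover have "T n \<le> M" for n
    unfolding T_def by (rule infsum_le_finite_sums[OF summ fin])
  ultimately have "T n \<le> T 0" by (rule bounded_convex_seq_le)
  also have "T 0 \<le> A"
    unfolding T_def by (rule infsum_le_finite_sums[OF summ]) (use A in \<open>simp add: g_def R_def\<close>)
  finally have "T n \<le> A" .
  moreover have "sum (g n) B \<le> T n"
    unfolding T_def by (rule finite_sum_le_infsum[OF summ]) (use B in \<open>auto simp: R_def g_def\<close>)
  ultimately show ?thesis by (simp add: g_def)
qed

section \<open>Stability under linear combinations and horizontal translations\<close>

lemma rows_bounded_add: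
  assumes "0 < p" "rows_bounded p F M" "rows_bounded p G M'"
  shows "rows_bounded p (\<lambda>m n. F m n + G m n) (2 powr p * (M + M'))"
  unfolding rows_bounded_def
proof (intro allI impI)
  fix n and B :: "int set" assume B: "finite B"
  have "(\<Sum>m\<in>B. cmod (F m n + G m n) powr p) \<le> (\<Sum>m\<in>B. 2 powr p * (cmod (F m n) powr p + cmod (G m n) powr p))"
  proof (intro sum_mono)
    fix m
    have "cmod (F m n + G m n) powr p \<le> (cmod (F m n) + cmod (G m n)) powr p"
      using assms by (intro powr_mono2 norm_triangle_ineq) auto
    also have "\<dots> \<le> 2 powr p * (cmod (F m n) powr p + cmod (G m n) powr p)"
      using assms by (intro powr_add_le) auto
    finally show "cmod (F m n + G m n) powr p \<le> 2 powr p * (cmod (F m n) powr p + cmod (G m n) powr p)" .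
  qed
  also have "\<dots> = 2 powr p * ((\<Sum>m\<in>B. cmod (F m n) powr p) + (\<Sum>m\<in>B. cmod (G m n) powr p))"
    by (simp add: sum_distrib_left sum.distrib distrib_left)
  also have "\<dots> \<le> 2 powr p * (M + M')"
    using assms B unfolding rows_bounded_def by (intro mult_left_mono add_mono) auto
  finally show "(\<Sum>m\<in>B. cmod (F m n + G m n) powr p) \<le> 2 powr p * (M + M')" .
qed

lemma rows_bounded_cmult:
  assumes "rows_bounded p F M"
  shows "rows_bounded p (\<lambda>m n. c * F m n) (cmod c powr p * M)"
  using assms unfolding rows_bounded_def
  by (auto simp: norm_mult powr_mult sum_distrib_left[symmetric] intro!: mult_left_mono)

lemma rows_bounded_shift:
  assumes "rows_bounded p F M"
  shows "rows_bounded p (\<lambda>m n. F (m + s) n) M"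
  unfolding rows_bounded_def
proof (intro allI impI)
  fix n and B :: "int set" assume B: "finite B"
  have "(\<Sum>m\<in>B. cmod (F (m + s) n) powr p) = (\<Sum>m\<in>(\<lambda>m. m + s) ` B. cmod (F m n) powr p)"
    by (subst sum.reindex) (auto simp: inj_on_def)
  also have "\<dots> \<le> M" using assms B unfolding rows_bounded_def by blast
  finally show "(\<Sum>m\<in>B. cmod (F (m + s) n) powr p) \<le> M" .
qed

lemma rows_bounded_sum:
  assumes "0 < p" "finite J" "\<And>j. j \<in> J \<Longrightarrow> \<exists>M. rows_bounded p (F j) M"
  shows "\<exists>M. rows_bounded p (\<lambda>m n. \<Sum>j\<in>J. F j m n) M"
  using assms(2,3)
proof (induction J rule: finite_induct)
  case empty
  then show ?case by (auto simp: rows_bounded_def)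
next
  case (insert x J)
  then show ?case using rows_bounded_add[OF assms(1)] by simp blast
qed

lemma disc_hol_shift: "disc_hol F \<Longrightarrow> disc_hol (\<lambda>m n. F (m + s) n)"
  unfolding disc_hol_def by (simp add: add.assoc) (metis add.commute add.left_commute)

lemma disc_hol_cmult:
  assumes "disc_hol F"
  shows "disc_hol (\<lambda>m n. c * F m n)"
  unfolding disc_hol_def
proof (intro allI)
  fix m n
  have "c * F m n + \<i> * (c * F (m + 1) n) - c * F (m + 1) (Suc n) - \<i> * (c * F m (Suc n))
    = c * (F m n + \<i> * F (m + 1) n - F (m + 1) (Suc n) - \<i> * F m (Suc n))"
    by (simp add: algebra_simps)
  then show "c * F m n + \<i> * (c * F (m + 1) n) - c * F (m + 1) (Suc n) - \<i> * (c * F m (Suc n)) = 0"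
    using assms by (simp add: disc_hol_def)
qed

lemma disc_hol_add:
  assumes "disc_hol F" "disc_hol G"
  shows "disc_hol (\<lambda>m n. F m n + G m n)"
  unfolding disc_hol_def
proof (intro allI)
  fix m n
  have "F m n + \<i> * F (m + 1) n - F (m + 1) (Suc n) - \<i> * F m (Suc n) = 0"
    "G m n + \<i> * G (m + 1) n - G (m + 1) (Suc n) - \<i> * G m (Suc n) = 0"
    using assms by (auto simp: disc_hol_def)
  then show "F m n + G m n + \<i> * (F (m + 1) n + G (m + 1) n) - (F (m + 1) (Suc n) + G (m + 1) (Suc n)) - \<i> * (F m (Suc n) + G m (Suc n)) = 0"
    by algebra
qed

lemma disc_hol_sum:
  assumes "finite J" "\<And>j. j \<in> J \<Longrightarrow> disc_hol (F j)"
  shows "disc_hol (\<lambda>m n. \<Sum>j\<in>J. F j m n)"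
  using assms
proof (induction J rule: finite_induct)
  case empty
  then show ?case by (simp add: disc_hol_def)
next
  case (insert x J)
  then show ?case by (simp add: disc_hol_add)
qed

section \<open>The kernel with Kronecker boundary values on even points\<close>

text \<open>\<open>S = cayley t\<close> solves \<open>1 + \<i> * S - S * t - \<i> * t = 0\<close>,
  which is the condition for \<open>S^m * t^n\<close> to be discrete holomorphic in
  \<open>(m, n)\<close>.\<close>

definition cayley :: "complex \<Rightarrow> complex" where
  "cayley z = \<i> * (1 - \<i> * z) / (1 + \<i> * z)"

text \<open>In the variable \<open>cayley t\<close> on the unit circle, the weight
  \<open>2 / (1 + t^2)\<close> is arc length.\<close>

definition poisson_integrand :: "int \<Rightarrow> nat \<Rightarrow> real \<Rightarrow> complex" where
  "poisson_integrand m n t = cayley t powi m * of_real (t ^ n) * of_real (2 / (1 + t\<^sup>2))"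

text \<open>\<open>\<bar>t\<bar> \<le> 1\<close> prevents growth in \<open>n\<close>, and on this
  interval the Cayley transform runs over the upper half circle from -1 to 1. The mean of
  \<open>S^m\<close> over a half circle vanishes for even \<open>m\<close> other than 0, which is
  the source of the Kronecker values.\<close>

definition disc_kernel :: "int \<Rightarrow> nat \<Rightarrow> complex" where
  "disc_kernel m n = integral {-1..1} (poisson_integrand m n) / of_real pi"

lemma one_plus_i_real_nonzero: "1 + \<i> * of_real t \<noteq> 0" "1 - \<i> * of_real t \<noteq> 0"
  by (auto simp: complex_eq_iff)

lemma norm_cayley: "cmod (cayley (of_real t)) = 1"
proof -
  have "cmod (1 - \<i> * of_real t) = cmod (1 + \<i> * of_real t)" by (simp add: cmod_def)
  then show ?thesis using one_plus_i_real_nonzero[of t] by (simp add: cayley_def norm_mult norm_divide)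
qed

lemma cayley_nonzero: "cayley (of_real t) \<noteq> 0"
  using norm_cayley[of t] by auto

lemma cayley_deriv:
  "(cayley has_field_derivative cayley (of_real t) * (- 2 * \<i> / of_real (1 + t\<^sup>2))) (at (of_real t))"
proof -
  have n: "1 + of_real (t\<^sup>2) \<noteq> (0::complex)"
    by (metis of_real_1 of_real_add of_real_eq_0_iff sum_power2_eq_zero_iff one_neq_zero power_one)
  show ?thesis
    unfolding cayley_def[abs_def]
    apply (rule derivative_eq_intros refl one_plus_i_real_nonzero | simp add: one_plus_i_real_nonzero)+
    using n one_plus_i_real_nonzero[of t]
    apply (simp add: divide_simps)
    apply (simp add: algebra_simps power2_eq_square)
    done
qed

lemma cayley_powi_deriv:
  "((\<lambda>t. cayley (of_real t) powi m) has_vector_derivative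
     (- \<i> * of_int m) * (cayley (of_real t) powi m * of_real (2 / (1 + t\<^sup>2)))) (at t within S)"
proof -
  have "((\<lambda>z. cayley z powi m) has_field_derivative
     of_int m * cayley (of_real t) powi (m - 1) * (cayley (of_real t) * (- 2 * \<i> / of_real (1 + t\<^sup>2)))) (at (of_real t))"
    by (rule derivative_eq_intros cayley_deriv refl disjI2 cayley_nonzero)+
  also have "of_int m * cayley (of_real t) powi (m - 1) * (cayley (of_real t) * (- 2 * \<i> / of_real (1 + t\<^sup>2)))
    = (- \<i> * of_int m) * (cayley (of_real t) powi m * of_real (2 / (1 + t\<^sup>2)))"
    using cayley_nonzero[of t] by (simp add: power_int_diff)
  finally show ?thesis by (rule has_vector_derivative_real_field)
qed

lemma continuous_on_poisson_integrand: "continuous_on S (poisson_integrand m n)"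
proof -
  have c1: "continuous_on S (\<lambda>t. cayley (of_real t) powi m)"
    by (rule continuous_on_vector_derivative) (rule cayley_powi_deriv)
  have c2: "continuous_on S (\<lambda>t. of_real (t ^ n) :: complex)"
    by (intro continuous_intros)
  have "1 + t\<^sup>2 \<noteq> 0" for t :: real
    by (metis add_pos_nonneg less_irrefl zero_le_power2 zero_less_one)
  then have c3: "continuous_on S (\<lambda>t. of_real (2 / (1 + t\<^sup>2)) :: complex)"
    by (intro continuous_on_of_real continuous_intros) auto
  show ?thesis
    unfolding poisson_integrand_def[abs_def] by (rule continuous_on_mult[OF continuous_on_mult[OF c1 c2] c3])
qed

lemma poisson_integrand_has_integral:
  "(poisson_integrand m n has_integral of_real pi * disc_kernel m n) {-1..1}"
  using integrable_integral[OF integrable_continuous_interval[OF continuous_on_poisson_integrand]]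
  by (simp add: disc_kernel_def)

lemma disc_hol_kernel: "disc_hol disc_kernel"
  unfolding disc_hol_def
proof (intro allI)
  fix m n
  have "((\<lambda>t. poisson_integrand m n t + \<i> * poisson_integrand (m + 1) n t - poisson_integrand (m + 1) (Suc n) t
       - \<i> * poisson_integrand m (Suc n) t) has_integral
     (of_real pi * disc_kernel m n + \<i> * (of_real pi * disc_kernel (m + 1) n) - of_real pi * disc_kernel (m + 1) (Suc n)
       - \<i> * (of_real pi * disc_kernel m (Suc n)))) {-1..1}"
    by (intro has_integral_add has_integral_diff has_integral_mult_right poisson_integrand_has_integral)
  moreover have "poisson_integrand m n t + \<i> * poisson_integrand (m + 1) n t - poisson_integrand (m + 1) (Suc n) t
       - \<i> * poisson_integrand m (Suc n) t = 0" for t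
  proof -
    let ?S = "cayley (of_real t)"
    have S: "1 + \<i> * ?S - ?S * of_real t - \<i> * of_real t = 0"
      using one_plus_i_real_nonzero[of t] unfolding cayley_def by (simp add: divide_simps) (simp add: algebra_simps)
    have "poisson_integrand m n t + \<i> * poisson_integrand (m + 1) n t - poisson_integrand (m + 1) (Suc n) t
       - \<i> * poisson_integrand m (Suc n) t =
       ?S powi m * of_real (t ^ n) * of_real (2 / (1 + t\<^sup>2)) * (1 + \<i> * ?S - ?S * of_real t - \<i> * of_real t)"
    proof -
      have pow: "?S powi (m + 1) = ?S powi m * ?S" using cayley_nonzero[of t] by (simp add: power_int_add)
      define w :: complex where "w = of_real (2 / (1 + t\<^sup>2))"
      show ?thesis
        unfolding poisson_integrand_def pow w_def[symmetric] by (simp add: algebra_simps)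
    qed
    then show ?thesis by (simp add: S)
  qed
  ultimately have "of_real pi * disc_kernel m n + \<i> * (of_real pi * disc_kernel (m + 1) n) - of_real pi * disc_kernel (m + 1) (Suc n)
       - \<i> * (of_real pi * disc_kernel m (Suc n)) = 0"
    by (simp add: has_integral_0_eq)
  then have "of_real pi * (disc_kernel m n + \<i> * disc_kernel (m + 1) n - disc_kernel (m + 1) (Suc n) - \<i> * disc_kernel m (Suc n)) = 0"
    by (simp add: algebra_simps)
  then show "disc_kernel m n + \<i> * disc_kernel (m + 1) n - disc_kernel (m + 1) (Suc n) - \<i> * disc_kernel m (Suc n) = 0"
    by simp
qed

lemma cayley_1: "cayley 1 = 1" "cayley (- 1) = - 1"
proof -
  have "1 + \<i> \<noteq> 0" "1 - \<i> \<noteq> 0" by (auto simp: complex_eq_iff)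
  then show "cayley 1 = 1" "cayley (- 1) = - 1"
    by (simp_all add: cayley_def divide_eq_eq) (simp_all add: algebra_simps)
qed

text \<open>Integration by parts against \<open>(S\<^sup>m)' = - 2 \<i> m S\<^sup>m / (1 + t\<^sup>2)\<close> with \<open>S\<close> the Cayley transform.\<close>

lemma disc_kernel_by_parts:
  "((\<lambda>t. cayley (of_real t) powi m * of_real (real n * t ^ (n - 1))) has_integral
     1 - (- 1) powi m * (- 1) ^ n + \<i> * of_int m * of_real pi * disc_kernel m n) {-1..1}"
proof -
  let ?G = "\<lambda>t. cayley (of_real t) powi m * of_real (t ^ n)"
  have "((\<lambda>t. cayley (of_real t) powi m * of_real (real n * t ^ (n - 1)) + (- \<i> * of_int m) * poisson_integrand m n t)
     has_integral ?G 1 - ?G (- 1)) {-1..1}"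
  proof (rule fundamental_theorem_of_calculus)
    fix t :: real
    have p: "((\<lambda>t. of_real (t ^ n) :: complex) has_vector_derivative of_real (real n * t ^ (n - 1))) (at t within {-1..1})"
      by (rule has_vector_derivative_of_real) (auto intro!: derivative_eq_intros simp: has_real_derivative_iff_has_vector_derivative[symmetric])
    show "(?G has_vector_derivative cayley (of_real t) powi m * of_real (real n * t ^ (n - 1)) + (- \<i> * of_int m) * poisson_integrand m n t) (at t within {-1..1})"
      using has_vector_derivative_mult[OF cayley_powi_deriv p, of m]
      by (simp add: poisson_integrand_def mult_ac)
  qed simp
  from has_integral_diff[OF this has_integral_mult_right[OF poisson_integrand_has_integral[of m n], of "- \<i> * of_int m"]]
  show ?thesis by (simp add: cayley_1 mult_ac)
qed

text \<open>For \<open>n = 0\<close> the integral produced by parts is zero, so only the end points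
  \<open>t = 1\<close> and \<open>t = -1\<close> contribute. At \<open>m = 0\<close> the integral is
  an arctangent, which explains the division by \<open>pi\<close>.\<close>

lemma disc_kernel_row_0:
  "disc_kernel m 0 = (if m = 0 then 1 else if even m then 0 else 2 * \<i> / (of_real pi * of_int m))"
proof (cases "m = 0")
  case True
  have "((\<lambda>t. 2 / (1 + t\<^sup>2)) has_integral 2 * arctan 1 - 2 * arctan (- 1)) {-1..1::real}"
    by (rule fundamental_theorem_of_calculus)
       (auto intro!: derivative_eq_intros simp: has_real_derivative_iff_has_vector_derivative[symmetric] field_simps)
  then have "((\<lambda>t. of_real (2 / (1 + t\<^sup>2)) :: complex) has_integral of_real (2 * arctan 1 - 2 * arctan (- 1))) {-1..1::real}"
    by (rule has_integral_of_real)
  then have "(poisson_integrand 0 0 has_integral of_real pi) {-1..1}"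
    by (simp add: poisson_integrand_def[abs_def] arctan_minus arctan_one)
  then have "of_real pi * disc_kernel 0 0 = of_real pi"
    using poisson_integrand_has_integral has_integral_unique by blast
  then show ?thesis using True by simp
next
  case False
  have "((\<lambda>t. 0) has_integral 1 - (- 1) powi m + \<i> * of_int m * of_real pi * disc_kernel m 0) {-1..1::real}"
    using disc_kernel_by_parts[of m 0] by simp
  then have "1 - (- 1) powi m + \<i> * of_int m * of_real pi * disc_kernel m 0 = 0"
    by (simp add: has_integral_0_eq)
  then have "1 - (- 1) powi m = - (\<i> * of_int m * of_real pi * disc_kernel m 0)"
    by (rule eq_neg_iff_add_eq_0[THEN iffD2])
  then have "disc_kernel m 0 * (of_real pi * of_int m) = \<i> * (1 - (- 1) powi m)"
    by (simp add: mult_ac)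
  moreover have "(- 1) powi m = (if even m then 1 else - 1 :: complex)" by (simp add: power_int_minus_left)
  ultimately show ?thesis using False by (simp add: eq_divide_eq split: if_splits)
qed

text \<open>Uniformity in \<open>n\<close> holds because \<open>n * \<bar>t\<bar> ^ (n - 1)\<close>
  has integral at most 2 whatever \<open>n\<close> is. With the end point terms,
  \<open>pi * \<bar>m\<bar>\<close> times the kernel is at most 4, and
  \<open>1 + \<bar>m\<bar> \<le> pi * \<bar>m\<bar>\<close> for \<open>m \<noteq> 0\<close>.\<close>

lemma disc_kernel_bound: "cmod (disc_kernel m n) \<le> 4 / (1 + \<bar>of_int m\<bar>)"
proof (cases "m = 0")
  case True
  have "cmod (of_real pi * disc_kernel m n) \<le> 2 * Henstock_Kurzweil_Integration.content {-1..1::real}"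
  proof (rule has_integral_bound_real[OF _ _ poisson_integrand_has_integral])
    fix t :: real assume "t \<in> {-1..1} - {}"
    then have "\<bar>t\<bar> ^ n \<le> 1" by (intro power_le_one) auto
    moreover have "2 / (1 + t\<^sup>2) \<le> 2" by (simp add: divide_simps add_pos_nonneg)
    ultimately have "\<bar>t\<bar> ^ n * (2 / (1 + t\<^sup>2)) \<le> 1 * 2" by (intro mult_mono) auto
    then show "cmod (poisson_integrand m n t) \<le> 2"
      unfolding poisson_integrand_def norm_mult norm_of_real by (simp add: True power_abs)
  qed auto
  then have "pi * cmod (disc_kernel m n) \<le> 4" by (simp add: norm_mult)
  moreover have "1 * cmod (disc_kernel m n) \<le> pi * cmod (disc_kernel m n)"
    using pi_gt3 by (intro mult_right_mono) auto
  ultimately show ?thesis using True by simp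
next
  case False
  let ?I = "1 - (- 1) powi m * (- 1) ^ n + \<i> * of_int m * of_real pi * disc_kernel m n"
  \<comment> \<open>At \<open>n = 0\<close> the truncated exponent \<open>n - 1\<close> does no
    damage, since the factor \<open>real n\<close> is 0.\<close>
  have pw: "((\<lambda>t. real n * \<bar>t\<bar> ^ (n - 1)) has_integral (if n = 0 then 0 else 2)) {-1..1::real}"
  proof (cases "n = 0")
    case False
    have r0: "((\<lambda>t. real n * t ^ (n - 1)) has_integral 1 ^ n - 0 ^ n) {0..1::real}"
      by (rule fundamental_theorem_of_calculus)
         (auto intro!: derivative_eq_intros simp: has_real_derivative_iff_has_vector_derivative[symmetric])
    have r: "((\<lambda>t. real n * \<bar>t\<bar> ^ (n - 1)) has_integral 1) {0..1::real}"
      using has_integral_eq[OF _ r0, of "\<lambda>t. real n * \<bar>t\<bar> ^ (n - 1)"] False by (simp add: zero_power)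
    have l0: "((\<lambda>t. real n * (- t) ^ (n - 1)) has_integral - ((- 0) ^ n) - - ((- (- 1)) ^ n)) {-1..0::real}"
      by (rule fundamental_theorem_of_calculus)
         (auto intro!: derivative_eq_intros simp: has_real_derivative_iff_has_vector_derivative[symmetric])
    have l: "((\<lambda>t. real n * \<bar>t\<bar> ^ (n - 1)) has_integral 1) {-1..0::real}"
      using has_integral_eq[OF _ l0, of "\<lambda>t. real n * \<bar>t\<bar> ^ (n - 1)"] False by (simp add: zero_power)
    show ?thesis using has_integral_combine[OF _ _ l r] False by simp
  qed simp
  have "cmod ?I \<le> (if n = 0 then 0 else 2)"
  proof -
    have "norm (integral {-1..1} (\<lambda>t. cayley (of_real t) powi m * of_real (real n * t ^ (n - 1))))
        \<le> integral {-1..1} (\<lambda>t. real n * \<bar>t\<bar> ^ (n - 1))"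
    proof (rule integral_norm_bound_integral)
      show "(\<lambda>t. cayley (of_real t) powi m * of_real (real n * t ^ (n - 1))) integrable_on {-1..1}"
        using disc_kernel_by_parts by (rule has_integral_integrable)
      show "(\<lambda>t. real n * \<bar>t\<bar> ^ (n - 1)) integrable_on {-1..1}"
        using pw by (rule has_integral_integrable)
      show "norm (cayley (of_real t) powi m * of_real (real n * t ^ (n - 1))) \<le> real n * \<bar>t\<bar> ^ (n - 1)" for t
        unfolding norm_mult norm_power_int norm_cayley norm_of_real abs_mult power_abs by simp
    qed
    then have "cmod ?I \<le> integral {-1..1} (\<lambda>t. real n * \<bar>t\<bar> ^ (n - 1))"
      unfolding integral_unique[OF disc_kernel_by_parts] .
    then show ?thesis using integral_unique[OF pw] by simp
  qed
  also have "\<dots> \<le> 2" by simp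
  finally have I: "cmod ?I \<le> 2" .
  have "cmod (1 - (- 1) powi m * (- 1) ^ n) \<le> cmod 1 + cmod ((- 1) powi m * (- 1) ^ n)"
    by (rule norm_triangle_ineq4)
  then have J: "cmod (1 - (- 1) powi m * (- 1) ^ n) \<le> 2"
    by (simp add: norm_mult norm_power norm_power_int)
  have "cmod (\<i> * of_int m * of_real pi * disc_kernel m n) = cmod (?I - (1 - (- 1) powi m * (- 1) ^ n))" by simp
  also have "\<dots> \<le> 2 + 2" using norm_triangle_ineq4 I J by (meson add_mono order_trans)
  finally have "\<bar>of_int m\<bar> * pi * cmod (disc_kernel m n) \<le> 4" by (simp add: norm_mult)
  moreover have "(1 + \<bar>of_int m\<bar>) * cmod (disc_kernel m n) \<le> (\<bar>of_int m\<bar> * pi) * cmod (disc_kernel m n)"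
  proof (rule mult_right_mono)
    have "1 \<le> \<bar>m\<bar>" using False by simp
    then have "1 \<le> \<bar>of_int m :: real\<bar>" by linarith
    moreover have "\<bar>of_int m :: real\<bar> * 2 \<le> \<bar>of_int m\<bar> * pi" using pi_gt3 by (intro mult_left_mono) auto
    ultimately show "1 + \<bar>of_int m\<bar> \<le> \<bar>of_int m :: real\<bar> * pi" by linarith
  qed simp
  ultimately have "(1 + \<bar>of_int m\<bar>) * cmod (disc_kernel m n) \<le> 4" by linarith
  then show ?thesis by (simp add: pos_le_divide_eq mult.commute)
qed

text \<open>This brings finite superpositions of kernels within reach of the convexity
  argument.\<close>

lemma disc_kernel_rows_bounded:
  assumes "1 < p"
  obtains M where "rows_bounded p disc_kernel M"
proof -
  define g :: "nat \<Rightarrow> real" where "g n = 4 powr p * real (Suc n) powr (- p)" for n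
  have "summable (\<lambda>n. real n powr (- p))" using assms by (simp add: summable_real_powr_iff)
  then have s: "summable g"
    unfolding g_def by (intro summable_mult) (subst (asm) summable_Suc_iff[symmetric], assumption)
  have "rows_bounded p disc_kernel (2 * suminf g)"
    unfolding rows_bounded_def
  proof (intro allI impI)
    fix n and B :: "int set" assume "finite B"
    have "(\<Sum>m\<in>B. cmod (disc_kernel m n) powr p) \<le> (\<Sum>m\<in>B. g (nat \<bar>m\<bar>))"
    proof (intro sum_mono)
      fix m
      have "cmod (disc_kernel m n) powr p \<le> (4 / (1 + \<bar>of_int m\<bar>)) powr p"
        using assms by (intro powr_mono2 disc_kernel_bound) auto
      also have "\<dots> = g (nat \<bar>m\<bar>)" by (simp add: g_def powr_divide powr_minus_divide)
      finally show "cmod (disc_kernel m n) powr p \<le> g (nat \<bar>m\<bar>)" .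
    qed
    also have "\<dots> \<le> 2 * suminf g"
      by (rule sum_nat_abs_le[OF s _ \<open>finite B\<close>]) (simp add: g_def)
    finally show "(\<Sum>m\<in>B. cmod (disc_kernel m n) powr p) \<le> 2 * suminf g" .
  qed
  then show thesis by (rule that)
qed

section \<open>Boundary values\<close>

definition even_window :: "nat \<Rightarrow> int set" where
  "even_window N = {j. even j \<and> \<bar>j\<bar> \<le> int N}"

lemma finite_even_window: "finite (even_window N)"
  by (rule finite_subset[of _ "{- int N..int N}"]) (auto simp: even_window_def)

text \<open>Comparison of \<open>F\<close> with the superpositions of kernels having the same boundary values on a
  finite window of even points.  On the even class the error vanishes in the limit; the difference
  of neighbouring odd boundary points is controlled by even points, so the limiting error on odd
  points is constant, and being in \<open>\<ell>\<^sup>p\<close> it is zero.\<close>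

lemma odd_boundary_le:
  assumes p: "1 < p" and C: "hilb_bounded p C"
    and hol: "disc_hol F" and bdd: "rows_bounded p F M"
    and A: "\<And>B. \<lbrakk>finite B; B \<subseteq> {m. even m}\<rbrakk> \<Longrightarrow> (\<Sum>m\<in>B. cmod (F m 0) powr p) \<le> A"
    and B: "finite B" "B \<subseteq> {m. odd m}"
  shows "(\<Sum>m\<in>B. cmod (F m 0) powr p) \<le> 2 powr p * (2 * C) * A"
proof -
  have C0: "0 \<le> C" using C by (simp add: hilb_bounded_def)
  define C' where "C' = 2 powr p * (2 * C)"
  have C': "0 \<le> C'" using C0 by (simp add: C'_def)
  \<comment> \<open>The form \<open>m + - j\<close> matches the translation lemmas.\<close>
  define G where "G = (\<lambda>N m n. \<Sum>j\<in>even_window N. F j 0 * disc_kernel (m + - j) n)"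
  define D where "D = (\<lambda>N m n. F m n + - 1 * G N m n)"
  have holG: "disc_hol (G N)" for N
    unfolding G_def by (intro disc_hol_sum disc_hol_cmult disc_hol_shift disc_hol_kernel finite_even_window)
  have holD: "disc_hol (D N)" for N
    unfolding D_def by (intro disc_hol_add disc_hol_cmult hol holG)
  obtain K where K: "rows_bounded p disc_kernel K" using disc_kernel_rows_bounded[OF p] .
  have "\<exists>M. rows_bounded p (\<lambda>m n. F j 0 * disc_kernel (m + - j) n) M" for j
    using rows_bounded_cmult[OF rows_bounded_shift[OF K]] by blast
  then have "\<exists>M. rows_bounded p (G N) M" for N
    unfolding G_def using p finite_even_window by (intro rows_bounded_sum) auto
  then have bddD: "\<exists>M. rows_bounded p (D N) M" for N
    unfolding D_def using rows_bounded_add[OF _ bdd] rows_bounded_cmult p by (meson less_trans zero_less_one)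
  have D_even: "D N m 0 = (if \<bar>m\<bar> \<le> int N then 0 else F m 0)" if "even m" for N m
  proof -
    have "G N m 0 = (\<Sum>j\<in>even_window N. if j = m then F j 0 else 0)"
      unfolding G_def by (intro sum.cong refl) (use that in \<open>auto simp: disc_kernel_row_0 even_window_def\<close>)
    also have "\<dots> = (if \<bar>m\<bar> \<le> int N then F m 0 else 0)"
      using that finite_even_window by (simp add: even_window_def)
    finally show ?thesis by (simp add: D_def)
  qed
  \<comment> \<open>On odd boundary points the superposition is a truncated Hilbert transform of the
    even values of \<open>F\<close>.\<close>
  have G_odd: "G N m 0 = 2 * \<i> / of_real pi * (\<Sum>j\<in>even_window N. F j 0 / of_int (m - j))" if "odd m" for N m
    unfolding G_def sum_distrib_left
    by (intro sum.cong refl) (use that in \<open>auto simp: disc_kernel_row_0 even_window_def\<close>)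
  have c1: "cmod (2 * \<i> / of_real pi) \<le> 1" using pi_gt3 by (simp add: norm_divide norm_mult)
  have conj: "(\<Sum>m\<in>B. cmod (2 * \<i> / of_real pi * (\<Sum>j\<in>J. F j 0 / of_int (m - j))) powr p)
      \<le> C' * (\<Sum>j\<in>J. cmod (F j 0) powr p)" if "finite J" "finite B" for J B
  proof -
    have "(\<Sum>m\<in>B. cmod (2 * \<i> / of_real pi * (\<Sum>j\<in>J. F j 0 / of_int (m - j))) powr p)
      \<le> (\<Sum>m\<in>B. cmod (\<Sum>j\<in>J. F j 0 / of_int (m - j)) powr p)"
      using p by (intro sum_mono powr_mono2) (auto simp only: norm_mult intro!: mult_left_le_one_le c1 norm_ge_zero mult_nonneg_nonneg)
    also have "\<dots> \<le> C' * (\<Sum>j\<in>J. cmod (F j 0) powr p)"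
      unfolding C'_def by (rule hilb_bounded_complex[OF C]) (use p that in auto)
    finally show ?thesis .
  qed
  have tail: "\<exists>N0. \<forall>B. finite B \<longrightarrow> B \<subseteq> {m. even m} \<longrightarrow> (\<forall>m\<in>B. int N0 < \<bar>m\<bar>) \<longrightarrow> (\<Sum>m\<in>B. cmod (F m 0) powr p) \<le> \<epsilon>"
    if \<epsilon>: "0 < \<epsilon>" for \<epsilon>
  proof -
    let ?g = "\<lambda>m. cmod (F m 0) powr p"
    have summ: "?g summable_on {m. even m}"
      by (rule nonneg_bdd_above_summable_on) (auto simp: bdd_above_def intro!: exI[of _ A] A)
    obtain X where X: "finite X" "X \<subseteq> {m. even m}" "dist (sum ?g X) (infsum ?g {m. even m}) \<le> \<epsilon>"
      using infsum_finite_approximation[OF summ \<epsilon>] by blast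
    define N0 where "N0 = nat (\<Sum>j\<in>X. \<bar>j\<bar>)"
    have N0: "\<bar>j\<bar> \<le> int N0" if "j \<in> X" for j
    proof -
      have "\<bar>j\<bar> \<le> (\<Sum>j\<in>X. \<bar>j\<bar>)" using X that by (intro member_le_sum) auto
      then show ?thesis by (simp add: N0_def)
    qed
    have "sum ?g Y \<le> \<epsilon>" if Y: "finite Y" "Y \<subseteq> {m. even m}" "\<forall>m\<in>Y. int N0 < \<bar>m\<bar>" for Y
    proof -
      have "X \<inter> Y = {}" using N0 Y(3) by force
      then have "sum ?g X + sum ?g Y = sum ?g (X \<union> Y)" using X Y by (simp add: sum.union_disjoint)
      also have "\<dots> \<le> infsum ?g {m. even m}"
        using X Y by (intro finite_sum_le_infsum summ) auto
      finally show ?thesis using X(3) by (simp add: dist_real_def)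
    qed
    then show ?thesis by blast
  qed
  have small: "norm x < e" if "0 < e" "norm x powr p \<le> (e / 2) powr p" for x :: complex and e
  proof -
    have "norm x \<le> e / 2" using powr_less_mono2[of p "e / 2" "norm x"] that p by fastforce
    then show ?thesis using that by simp
  qed
  \<comment> \<open>On even boundary points \<open>D N\<close> is the tail of \<open>F\<close>
    outside the window. Its smallness spreads over the whole even class, whatever row bound
    \<open>M'\<close> the function \<open>D N\<close> has.\<close>
  have D_lim: "(\<lambda>N. D N m n) \<longlonglongrightarrow> 0" if mn: "even (m + int n)" for m n
  proof (rule LIMSEQ_I)
    fix e :: real assume e: "0 < e"
    obtain N0 where N0: "\<And>B. \<lbrakk>finite B; B \<subseteq> {m. even m}; \<forall>m\<in>B. int N0 < \<bar>m\<bar>\<rbrakk> \<Longrightarrow> (\<Sum>m\<in>B. cmod (F m 0) powr p) \<le> (e / 2) powr p"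
      using tail[of "(e / 2) powr p"] e by auto
    have "norm (D N m n - 0) < e" if N: "N \<ge> N0" for N
    proof -
      obtain M' where M': "rows_bounded p (D N) M'" using bddD by blast
      have "(\<Sum>m\<in>{m}. cmod (D N m n) powr p) \<le> (e / 2) powr p"
      proof (rule parity_class_row_le[OF _ holD M', where c = 0])
        fix X :: "int set" assume X: "finite X" "X \<subseteq> {m. even (m + 0)}"
        have "(\<Sum>m\<in>X. cmod (D N m 0) powr p) = (\<Sum>m\<in>{m\<in>X. int N < \<bar>m\<bar>}. cmod (F m 0) powr p)"
          using X by (intro sum.mono_neutral_cong_right) (auto simp: D_even subset_iff split: if_splits)
        also have "\<dots> \<le> (e / 2) powr p" using X N by (intro N0) auto
        finally show "(\<Sum>m\<in>X. cmod (D N m 0) powr p) \<le> (e / 2) powr p" .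
      qed (use p mn in auto)
      then show ?thesis using small[OF e] by simp
    qed
    then show "\<exists>no. \<forall>N\<ge>no. norm (D N m n - 0) < e" by blast
  qed
  \<comment> \<open>Two superpositions differ by the transform of the even values between the two
    windows, which \<open>conj\<close> bounds by a tail.\<close>
  have "convergent (\<lambda>N. G N m 0)" if m: "odd m" for m
    unfolding Cauchy_convergent_iff[symmetric] Cauchy_altdef2
  proof (intro allI impI)
    fix e :: real assume e: "0 < e"
    define \<epsilon> where "\<epsilon> = (e / 2) powr p / (C' + 1)"
    have \<epsilon>: "0 < \<epsilon>" "C' * \<epsilon> \<le> (e / 2) powr p" using e C' by (auto simp: \<epsilon>_def field_simps)
    obtain N0 where N0: "\<And>B. \<lbrakk>finite B; B \<subseteq> {m. even m}; \<forall>m\<in>B. int N0 < \<bar>m\<bar>\<rbrakk> \<Longrightarrow> (\<Sum>m\<in>B. cmod (F m 0) powr p) \<le> \<epsilon>"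
      using tail[OF \<epsilon>(1)] by auto
    have "dist (G N m 0) (G N0 m 0) < e" if "N \<ge> N0" for N
    proof -
      let ?J = "even_window N - even_window N0"
      have sub: "even_window N0 \<subseteq> even_window N" using that by (auto simp: even_window_def)
      have "G N m 0 - G N0 m 0 = 2 * \<i> / of_real pi * (\<Sum>j\<in>?J. F j 0 / of_int (m - j))"
        unfolding G_odd[OF m] by (simp only: right_diff_distrib[symmetric] sum_diff[OF finite_even_window sub])
      then have "cmod (G N m 0 - G N0 m 0) powr p \<le> C' * (\<Sum>j\<in>?J. cmod (F j 0) powr p)"
        using conj[of ?J "{m}"] finite_even_window by simp
      also have "\<dots> \<le> C' * \<epsilon>"
        using finite_even_window C' by (intro mult_left_mono N0) (auto simp: even_window_def)
      also have "\<dots> \<le> (e / 2) powr p" by (rule \<epsilon>)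
      finally show ?thesis using small[OF e] by (simp add: dist_norm)
    qed
    then show "\<exists>N. \<forall>n\<ge>N. dist (G n m 0) (G N m 0) < e" by blast
  qed
  then obtain L where L: "\<And>m. odd m \<Longrightarrow> (\<lambda>N. G N m 0) \<longlonglongrightarrow> L m"
    unfolding convergent_def by metis
  have DL: "(\<lambda>N. D N m 0) \<longlonglongrightarrow> F m 0 - L m" if "odd m" for m
  proof -
    have "(\<lambda>N. F m 0 + - 1 * G N m 0) \<longlonglongrightarrow> F m 0 + - 1 * L m" by (intro tendsto_intros L that)
    then show ?thesis by (simp add: D_def)
  qed
  have G_le: "(\<Sum>m\<in>B. cmod (G N m 0) powr p) \<le> C' * A" if "finite B" "B \<subseteq> {m. odd m}" for N B
  proof -
    have "(\<Sum>m\<in>B. cmod (G N m 0) powr p) \<le> C' * (\<Sum>j\<in>even_window N. cmod (F j 0) powr p)"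
      using conj[OF finite_even_window that(1), of N] that(2) by (simp add: G_odd subset_iff)
    also have "\<dots> \<le> C' * A"
      using finite_even_window C' by (intro mult_left_mono A) (auto simp: even_window_def)
    finally show ?thesis .
  qed
  have L_le: "(\<Sum>m\<in>B. cmod (L m) powr p) \<le> C' * A" if "finite B" "B \<subseteq> {m. odd m}" for B
  proof (rule tendsto_upperbound)
    show "(\<lambda>N. \<Sum>m\<in>B. cmod (G N m 0) powr p) \<longlonglongrightarrow> (\<Sum>m\<in>B. cmod (L m) powr p)"
      using that p by (intro tendsto_sum tendsto_powr' tendsto_norm L tendsto_const) auto
  qed (use G_le that in auto)
  define E where "E = (\<lambda>m. F m 0 - L m)"
  \<comment> \<open>Eliminating the odd-class point \<open>(m + 1, 1)\<close> from two adjacent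
    squares expresses the difference at \<open>m + 2\<close> and \<open>m\<close> through three
    points of the even class, where \<open>D N\<close> tends to 0.\<close>
  have E_periodic: "E (m + 2) = E m" if m: "odd m" for m
  proof -
    have "(\<lambda>N. D N (m + 2) 0 - D N m 0) \<longlonglongrightarrow> E (m + 2) - E m"
      unfolding E_def by (intro tendsto_diff DL) (use m in auto)
    moreover have "D N (m + 2) 0 - D N m 0 = - \<i> * D N (m + 2) 1 + 2 * \<i> * D N (m + 1) 0 - \<i> * D N m 1" for N
    proof -
      have "D N m 0 + \<i> * D N (m + 1) 0 - D N (m + 1) 1 - \<i> * D N m 1 = 0"
        "D N (m + 1) 0 + \<i> * D N (m + 2) 0 - D N (m + 2) 1 - \<i> * D N (m + 1) 1 = 0"
        using holD[unfolded disc_hol_def, rule_format, of N m 0] holD[unfolded disc_hol_def, rule_format, of N "m + 1" 0]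
        by (simp_all add: add.assoc)
      moreover have "\<i> * \<i> = -1" by simp
      ultimately show ?thesis by algebra
    qed
    moreover have "(\<lambda>N. - \<i> * D N (m + 2) 1 + 2 * \<i> * D N (m + 1) 0 - \<i> * D N m 1) \<longlonglongrightarrow> - \<i> * 0 + 2 * \<i> * 0 - \<i> * 0"
      by (intro tendsto_intros D_lim) (use m in auto)
    ultimately have "E (m + 2) - E m = 0" using LIMSEQ_unique by fastforce
    then show ?thesis by simp
  qed
  define R where "R = 2 powr p * (M + C' * A)"
  have E_le: "(\<Sum>m\<in>B. cmod (E m) powr p) \<le> R" if B: "finite B" "B \<subseteq> {m. odd m}" for B
  proof -
    have "(\<Sum>m\<in>B. cmod (E m) powr p) \<le> (\<Sum>m\<in>B. 2 powr p * (cmod (F m 0) powr p + cmod (L m) powr p))"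
    proof (intro sum_mono)
      fix m
      have "cmod (E m) powr p \<le> (cmod (F m 0) + cmod (L m)) powr p"
        unfolding E_def using p by (intro powr_mono2 norm_triangle_ineq4) auto
      also have "\<dots> \<le> 2 powr p * (cmod (F m 0) powr p + cmod (L m) powr p)"
        using p by (intro powr_add_le) auto
      finally show "cmod (E m) powr p \<le> 2 powr p * (cmod (F m 0) powr p + cmod (L m) powr p)" .
    qed
    also have "\<dots> = 2 powr p * ((\<Sum>m\<in>B. cmod (F m 0) powr p) + (\<Sum>m\<in>B. cmod (L m) powr p))"
      by (simp add: sum_distrib_left sum.distrib distrib_left)
    also have "\<dots> \<le> R"
      unfolding R_def using bdd L_le[OF B] B unfolding rows_bounded_def by (intro mult_left_mono add_mono) auto
    finally show ?thesis .
  qed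
  \<comment> \<open>A nonzero value would recur along \<open>m + 2 * i\<close>, and enough copies of
    its p-th power would exceed \<open>R\<close>.\<close>
  have E_0: "E m = 0" if m: "odd m" for m
  proof (rule ccontr)
    assume "E m \<noteq> 0"
    then have pos: "0 < cmod (E m) powr p" by simp
    have E_eq: "E (m + 2 * int i) = E m" for i
    proof (induction i)
      case (Suc i)
      then show ?case using E_periodic[of "m + 2 * int i"] m by (simp add: algebra_simps)
    qed simp
    obtain k where k: "R < real k * cmod (E m) powr p" using reals_Archimedean3[OF pos] by blast
    have "(\<Sum>x\<in>(\<lambda>i. m + 2 * int i) ` {..<k}. cmod (E x) powr p) = (\<Sum>i<k. cmod (E m) powr p)"
      by (subst sum.reindex) (auto simp: inj_on_def E_eq)
    also have "\<dots> = real k * cmod (E m) powr p" by simp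
    finally have "(\<Sum>x\<in>(\<lambda>i. m + 2 * int i) ` {..<k}. cmod (E x) powr p) = real k * cmod (E m) powr p" .
    moreover have "(\<lambda>i. m + 2 * int i) ` {..<k} \<subseteq> {m. odd m}" using m by auto
    ultimately show False using E_le[of "(\<lambda>i. m + 2 * int i) ` {..<k}"] k by simp
  qed
  \<comment> \<open>Now \<open>F\<close> equals \<open>L\<close> on odd boundary points and inherits
    its bound, which involves \<open>A\<close> and \<open>C'\<close> but not
    \<open>M\<close>.\<close>
  have "(\<Sum>m\<in>B. cmod (F m 0) powr p) = (\<Sum>m\<in>B. cmod (L m) powr p)"
  proof (intro sum.cong refl)
    fix m assume "m \<in> B"
    then have "E m = 0" using E_0 B by blast
    then show "cmod (F m 0) powr p = cmod (L m) powr p" by (simp add: E_def)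
  qed
  then show ?thesis using L_le[OF B] by (simp add: C'_def)
qed

lemma rows_le_even_boundary:
  assumes p: "1 < p" and C: "hilb_bounded p C"
    and hol: "disc_hol F" and bdd: "rows_bounded p F M"
    and A: "\<And>B. \<lbrakk>finite B; B \<subseteq> {m. even m}\<rbrakk> \<Longrightarrow> (\<Sum>m\<in>B. cmod (F m 0) powr p) \<le> A"
  shows "rows_bounded p F ((1 + 2 powr p * (2 * C)) * A)"
  unfolding rows_bounded_def
proof (intro allI impI)
  fix n and B :: "int set" assume B: "finite B"
  have "(\<Sum>m\<in>B. cmod (F m n) powr p) = (\<Sum>m\<in>{m\<in>B. even (m + int n)} \<union> {m\<in>B. odd (m + int n)}. cmod (F m n) powr p)"
    by (rule sum.cong) auto
  also have "\<dots> = (\<Sum>m\<in>{m\<in>B. even (m + int n)}. cmod (F m n) powr p) + (\<Sum>m\<in>{m\<in>B. odd (m + int n)}. cmod (F m n) powr p)"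
    using B by (intro sum.union_disjoint) auto
  also have "\<dots> \<le> A + 2 powr p * (2 * C) * A"
  proof (intro add_mono)
    show "(\<Sum>m\<in>{m\<in>B. even (m + int n)}. cmod (F m n) powr p) \<le> A"
      by (rule parity_class_row_le[OF _ hol bdd, where c = 0]) (use p A B in auto)
    show "(\<Sum>m\<in>{m\<in>B. odd (m + int n)}. cmod (F m n) powr p) \<le> 2 powr p * (2 * C) * A"
    proof (rule parity_class_row_le[OF _ hol bdd, where c = 1])
      fix X :: "int set" assume "finite X" "X \<subseteq> {m. even (m + 1)}"
      then show "(\<Sum>m\<in>X. cmod (F m 0) powr p) \<le> 2 powr p * (2 * C) * A"
        by (intro odd_boundary_le[OF p C hol bdd A]) auto
    qed (use p B in auto)
  qed
  finally show "(\<Sum>m\<in>B. cmod (F m n) powr p) \<le> (1 + 2 powr p * (2 * C)) * A"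
    by (simp add: algebra_simps)
qed

text \<open>The equation and the row sums are invariant under horizontal translation, so the odd
  case is the even case moved by one.\<close>

lemma rows_le_parity_boundary:
  assumes p: "1 < p" and C: "hilb_bounded p C"
    and hol: "disc_hol F" and bdd: "rows_bounded p F M"
    and A: "\<And>B. \<lbrakk>finite B; B \<subseteq> {m. even (m + s)}\<rbrakk> \<Longrightarrow> (\<Sum>m\<in>B. cmod (F m 0) powr p) \<le> A"
  shows "rows_bounded p F ((1 + 2 powr p * (2 * C)) * A)"
proof -
  have "rows_bounded p (\<lambda>m n. F (m + s) n) ((1 + 2 powr p * (2 * C)) * A)"
  proof (rule rows_le_even_boundary[OF p C disc_hol_shift[OF hol] rows_bounded_shift[OF bdd]])
    fix B :: "int set" assume B: "finite B" "B \<subseteq> {m. even m}"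
    have "(\<Sum>m\<in>B. cmod (F (m + s) 0) powr p) = (\<Sum>m\<in>(\<lambda>m. m + s) ` B. cmod (F m 0) powr p)"
      by (subst sum.reindex) (auto simp: inj_on_def)
    also have "\<dots> \<le> A" using B by (intro A) auto
    finally show "(\<Sum>m\<in>B. cmod (F (m + s) 0) powr p) \<le> A" .
  qed
  from rows_bounded_shift[OF this, of "- s"] show ?thesis by simp
qed

section \<open>Sampling\<close>

text \<open>The bridge from the extended norm to finite sums. If the full sum is infinite, both
  sides fail, since no real \<open>c\<close> bounds the partial sums.\<close>

lemma lp_norm_le_iff:
  assumes "0 < p" "0 \<le> c"
  shows "lp_norm p A g \<le> ennreal c \<longleftrightarrow> (\<forall>B. finite B \<longrightarrow> B \<subseteq> A \<longrightarrow> (\<Sum>x\<in>B. cmod (g x) powr p) \<le> c powr p)"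
proof -
  define S where "S = (\<Sum>\<^sub>\<infinity>x\<in>A. ennreal (cmod (g x) powr p))"
  have Sle: "S \<le> ennreal (c powr p) \<longleftrightarrow> (\<forall>B. finite B \<longrightarrow> B \<subseteq> A \<longrightarrow> (\<Sum>x\<in>B. cmod (g x) powr p) \<le> c powr p)"
  proof -
    have "S = (SUP B\<in>{B. finite B \<and> B \<subseteq> A}. \<Sum>x\<in>B. ennreal (cmod (g x) powr p))"
      unfolding S_def by (rule nonneg_infsum_complete) simp
    also have "\<dots> = (SUP B\<in>{B. finite B \<and> B \<subseteq> A}. ennreal (\<Sum>x\<in>B. cmod (g x) powr p))"
      by (intro SUP_cong refl sum_ennreal) auto
    finally show ?thesis by (auto simp: SUP_le_iff)
  qed
  have "lp_norm p A g \<le> ennreal c \<longleftrightarrow> S \<le> ennreal (c powr p)"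
  proof (cases S)
    case (real r)
    have "lp_norm p A g = ennreal (r powr (1 / p))"
      using real unfolding lp_norm_def S_def[symmetric] by simp
    moreover have "r powr (1 / p) \<le> c \<longleftrightarrow> r \<le> c powr p"
    proof
      assume "r powr (1 / p) \<le> c"
      then have "(r powr (1 / p)) powr p \<le> c powr p" using assms by (intro powr_mono2) auto
      then show "r \<le> c powr p" using assms real by (simp add: powr_powr)
    next
      assume "r \<le> c powr p"
      then have "r powr (1 / p) \<le> (c powr p) powr (1 / p)" using assms real by (intro powr_mono2) auto
      then show "r powr (1 / p) \<le> c" using assms by (simp add: powr_powr)
    qed
    ultimately show ?thesis using real assms by simp
  next
    case top
    then show ?thesis unfolding lp_norm_def S_def[symmetric] by (simp add: top_unique)
  qed
  then show ?thesis using Sle by simp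
qed

lemma lp_norm_reindex: "inj_on h A \<Longrightarrow> lp_norm p (h ` A) g = lp_norm p A (\<lambda>x. g (h x))"
  by (simp add: lp_norm_def infsum_reindex comp_def)

lemma lp_norm_mono:
  assumes "0 < p" "A \<subseteq> B"
  shows "lp_norm p A g \<le> lp_norm p B g"
proof (cases "lp_norm p B g")
  case (real c)
  then have "lp_norm p B g \<le> ennreal c" by simp
  then have "\<forall>X. finite X \<longrightarrow> X \<subseteq> B \<longrightarrow> (\<Sum>x\<in>X. cmod (g x) powr p) \<le> c powr p"
    using assms real by (subst (asm) lp_norm_le_iff) auto
  then have "lp_norm p A g \<le> ennreal c"
    using assms real by (subst lp_norm_le_iff) auto
  then show ?thesis using real by simp
qed simp

lemma Hp_norm_parity_bounds:
  assumes p: "1 < p"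
  obtains C where "0 < C"
    "\<And>f s. f \<in> Hp p \<Longrightarrow> lp_norm p {m. even (m + s)} (\<lambda>m. f (of_int m)) \<le> Hp_norm p f"
    "\<And>f s. f \<in> Hp p \<Longrightarrow> Hp_norm p f \<le> ennreal C * lp_norm p {m. even (m + s)} (\<lambda>m. f (of_int m))"
proof -
  obtain C where C: "hilb_bounded p C" using hilb_bounded_exists[OF p] ..
  define K where "K = 1 + 2 powr p * (2 * C)"
  have K: "0 < K" using C by (auto simp: K_def hilb_bounded_def add_pos_nonneg)
  have le: "lp_norm p {m. even (m + s)} (\<lambda>m. f (of_int m)) \<le> Hp_norm p f" for f s
  proof -
    have "lp_norm p {m. even (m + s)} (\<lambda>m. f (of_int m)) \<le> lp_norm p UNIV (\<lambda>m. f (of_int m))"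
      using p by (intro lp_norm_mono) auto
    also have "\<dots> \<le> Hp_norm p f" unfolding Hp_norm_def by (rule SUP_upper2[of 0]) auto
    finally show ?thesis .
  qed
  have ge: "Hp_norm p f \<le> ennreal (K powr (1 / p)) * lp_norm p {m. even (m + s)} (\<lambda>m. f (of_int m))" if f: "f \<in> Hp p" for f s
  proof -
    define F where "F = (\<lambda>m n. f (of_int m + \<i> * of_nat n))"
    obtain H where H: "0 \<le> H" "Hp_norm p f = ennreal H"
      using f by (cases "Hp_norm p f") (auto simp: Hp_def)
    \<comment> \<open>Finiteness of the boundary norm is supplied by the easy inequality
      \<open>le\<close>.\<close>
    obtain a where a: "0 \<le> a" "lp_norm p {m. even (m + s)} (\<lambda>m. f (of_int m)) = ennreal a"
      using le[of s f] H by (cases "lp_norm p {m. even (m + s)} (\<lambda>m. f (of_int m))") (auto simp: top_unique)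
    have hol: "disc_hol F"
      unfolding disc_hol_def
    proof (intro allI)
      fix m :: int and n :: nat
      let ?z = "of_int m + \<i> * of_nat n :: complex"
      have "?z \<in> Z2_plus"
        unfolding Z2_plus_def mem_Collect_eq by (intro exI[of _ m] exI[of _ "int n"]) simp
      then have "f ?z + \<i> * f (?z + 1) - f (?z + 1 + \<i>) - \<i> * f (?z + \<i>) = 0"
        using f by (auto simp: Hp_def Hol_def)
      then show "F m n + \<i> * F (m + 1) n - F (m + 1) (Suc n) - \<i> * F m (Suc n) = 0"
        by (simp add: F_def algebra_simps)
    qed
    have "lp_norm p UNIV (\<lambda>m. F m n) \<le> ennreal H" for n
      unfolding H(2)[symmetric] Hp_norm_def F_def by (rule SUP_upper) simp
    then have bdd: "rows_bounded p F (H powr p)"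
      using p H unfolding rows_bounded_def by (simp add: lp_norm_le_iff)
    have "lp_norm p {m. even (m + s)} (\<lambda>m. F m 0) \<le> ennreal a" using a by (simp add: F_def)
    then have "(\<Sum>m\<in>B. cmod (F m 0) powr p) \<le> a powr p" if "finite B" "B \<subseteq> {m. even (m + s)}" for B
      using p a that by (simp add: lp_norm_le_iff)
    from rows_le_parity_boundary[OF p C hol bdd this]
    have rb: "rows_bounded p F (K * a powr p)" by (simp add: K_def)
    have eq: "(K powr (1 / p) * a) powr p = K * a powr p"
      using p K a by (simp add: powr_mult powr_powr)
    have "lp_norm p UNIV (\<lambda>m. F m n) \<le> ennreal (K powr (1 / p) * a)" for n
      using p K a rb by (subst lp_norm_le_iff) (auto simp: eq rows_bounded_def)
    then have "Hp_norm p f \<le> ennreal (K powr (1 / p) * a)"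
      unfolding Hp_norm_def F_def by (intro SUP_least)
    then show ?thesis using a by (simp add: ennreal_mult)
  qed
  show thesis using that[of "K powr (1 / p)"] K le ge by simp
qed

theorem proposition7p3:
  fixes p :: real
  assumes "1 < p"
  shows "sampling_set p Lambda0_even \<and> sampling_set p Lambda0_odd \<and>
    (\<exists>C::real. C > 0 \<and>
      (\<forall>f\<in>Hp p. lp_norm p Lambda0_even f \<le> Hp_norm p f \<and>
                Hp_norm p f \<le> ennreal C * lp_norm p Lambda0_even f)) \<and>
    (\<exists>C::real. C > 0 \<and>
      (\<forall>f\<in>Hp p. lp_norm p Lambda0_odd f \<le> Hp_norm p f \<and>
                Hp_norm p f \<le> ennreal C * lp_norm p Lambda0_odd f))"
proof -
  have "{m. even (m + 0)} = range (\<lambda>m::int. 2 * m)" by (auto elim!: evenE)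
  then have even_eq: "Lambda0_even = of_int ` {m. even (m + 0)}"
    unfolding Lambda0_even_def by (simp add: full_SetCompr_eq image_image)
  have "{m. even (m + 1)} = range (\<lambda>m::int. 2 * m + 1)" by (auto elim!: oddE)
  then have odd_eq: "Lambda0_odd = of_int ` {m. even (m + 1)}"
    unfolding Lambda0_odd_def by (simp add: full_SetCompr_eq image_image)
  obtain C where C: "0 < C"
    "\<And>f s. f \<in> Hp p \<Longrightarrow> lp_norm p {m. even (m + s)} (\<lambda>m. f (of_int m)) \<le> Hp_norm p f"
    "\<And>f s. f \<in> Hp p \<Longrightarrow> Hp_norm p f \<le> ennreal C * lp_norm p {m. even (m + s)} (\<lambda>m. f (of_int m))"
    using Hp_norm_parity_bounds[OF assms] by blast
  have bounds: "\<forall>f\<in>Hp p. lp_norm p \<Lambda> f \<le> Hp_norm p f \<and> Hp_norm p f \<le> ennreal C * lp_norm p \<Lambda> f"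
    if "\<Lambda> = of_int ` {m. even (m + s)}" for \<Lambda> s
    unfolding that using C by (subst (1 2) lp_norm_reindex) (auto simp: inj_on_def)
  have "range of_int \<subseteq> Z2_plus"
  proof
    fix z :: complex assume "z \<in> range of_int"
    then obtain m where "z = of_int m + \<i> * of_int 0" by auto
    then show "z \<in> Z2_plus" unfolding Z2_plus_def by blast
  qed
  \<comment> \<open>The lower constant is 1, since the sampled points lie in one of the rows over
    which the supremum is taken.\<close>
  then have "sampling_set p \<Lambda>" if "\<Lambda> = of_int ` {m. even (m + s)}" for \<Lambda> s
    using bounds[OF that] C(1) unfolding sampling_set_def that by (intro conjI exI[of _ 1] exI[of _ C]) auto
  with bounds[OF even_eq] bounds[OF odd_eq] even_eq odd_eq C(1) show ?thesis by blast
qed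

end
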